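(* Let $0<p^\ast<p\le0.5$, and let $p^{\prime}$ be a node of the uniform grid with step $h$ on the interval $[p^\ast,0.5]$ closest to $p$. Then for all integers $n\ge1$ and $0\le k\le n$, $$\left|\frac{1}{\varrho(p)}\,\Delta_{n,k}(p)-\frac{1}{\varrho(p^\prime)}\,\Delta_{n,k}(p^\prime)\right|\le\frac{h}{2}\,L(p^\ast),$$ where, with $q=1-p$, $$L(p)=\frac{1}{(1-2pq)\sqrt{pq}}\left(\frac{c_1}{p}+c_2+c_3\,\frac{(1-2p)(1+2pq)}{1-2pq}\right),\qquad c_1=0.516,\quad c_2=0.121,\quad c_3=0.271.$$
   Context: The uniform grid with step $h>0$ on $[p^\ast,0.5]$ consists of the nodes $p^\ast+jh$, $j=0,1,\ldots,m$, where $p^\ast+mh=0.5$. $\Phi$ denotes the standard normal distribution function. For $p\in(0,1)$, $q=1-p$, let $X_1,X_2,\ldots$ be independent random variables with $\mathbf P(X_i=1)=p$, $\mathbf P(X_i=0)=q$. Put $F_{n,p}(x)=\mathbf P\left(\sum_{i=1}^n X_i<x\right)$, $G_{n,p}(x)=\Phi\left(\frac{x-np}{\sqrt{npq}}\right)$, $\varrho(p)=\frac{p^2+q^2}{\sqrt{pq}}$, and for integer $k$, $\Delta_{n,k}(p)=\max\left\{|F_{n,p}(k)-G_{n,p}(k)|,\ |F_{n,p}(k+1)-G_{n,p}(k)|\right\}$. *)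

theory Defs
  imports "HOL-Probability.Probability"
begin

definition Phi :: "real \<Rightarrow> real" where
  "Phi x = cdf std_normal_distribution x"

(* Canonical model of an i.i.d. sequence with P(X i = 1) = p and P(X i = 0) = 1 - p:
   the coordinates of the infinite product of Bernoulli distributions.  Lemma
   sum_less_eq_F below shows that the choice of the probability space is immaterial. *)
definition bernoulli_space :: "real \<Rightarrow> (nat \<Rightarrow> bool) measure" where
  "bernoulli_space p = Pi\<^sub>M UNIV (\<lambda>_. measure_pmf (bernoulli_pmf p))"

definition bernoulli_rv :: "nat \<Rightarrow> (nat \<Rightarrow> bool) \<Rightarrow> real" where
  "bernoulli_rv i \<omega> = of_bool (\<omega> i)"

(* Strict inequality: the left-continuous distribution function, unlike the library's cdf. *)
definition F :: "nat \<Rightarrow> real \<Rightarrow> real \<Rightarrow> real" where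
  "F n p x = measure (bernoulli_space p)
     {\<omega> \<in> space (bernoulli_space p). (\<Sum>i=1..n. bernoulli_rv i \<omega>) < x}"

definition G :: "nat \<Rightarrow> real \<Rightarrow> real \<Rightarrow> real" where
  "G n p x = Phi ((x - real n * p) / sqrt (real n * p * (1 - p)))"

definition rho :: "real \<Rightarrow> real" where
  "rho p = (p\<^sup>2 + (1 - p)\<^sup>2) / sqrt (p * (1 - p))"

(* G is evaluated at k in both terms: F at k + 1 is the right limit of F at k. *)
definition Delta :: "nat \<Rightarrow> int \<Rightarrow> real \<Rightarrow> real" where
  "Delta n k p = max \<bar>F n p (of_int k) - G n p (of_int k)\<bar>
                     \<bar>F n p (of_int (k + 1)) - G n p (of_int k)\<bar>"

definition L :: "real \<Rightarrow> real" where
  "L p = (let q = 1 - p; c1 = 0.516; c2 = 0.121; c3 = 0.271 in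
     1 / ((1 - 2 * p * q) * sqrt (p * q)) *
       (c1 / p + c2 + c3 * ((1 - 2 * p) * (1 + 2 * p * q) / (1 - 2 * p * q))))"

(* The nodes of the uniform grid with step h on [a, b], where b = a + m h. *)
definition grid_nodes :: "real \<Rightarrow> real \<Rightarrow> nat \<Rightarrow> real set" where
  "grid_nodes a h m = {a + real j * h | j. j \<le> m}"


lemma distr_eq_bernoulli:
  assumes "prob_space M" and [measurable]: "Y \<in> borel_measurable M" and p: "0 < p" "p < 1"
    and Y1: "measure M {\<omega> \<in> space M. Y \<omega> = (1::real)} = p"
    and Y0: "measure M {\<omega> \<in> space M. Y \<omega> = 0} = 1 - p"
  shows "distr M borel Y = distr (measure_pmf (bernoulli_pmf p)) borel of_bool"
proof (rule measure_eqI)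
  interpret prob_space M by fact
  fix A :: "real set" assume "A \<in> sets (distr M borel Y)"
  then have [measurable]: "A \<in> sets borel" by simp
  have "prob {\<omega> \<in> space M. Y \<omega> = 1 \<or> Y \<omega> = 0}
      = prob ({\<omega> \<in> space M. Y \<omega> = 1} \<union> {\<omega> \<in> space M. Y \<omega> = 0})"
    by (rule arg_cong[where f = prob]) auto
  also have "\<dots> = p + (1 - p)"
    by (subst finite_measure_Union) (auto simp: Y1 Y0)
  finally have ae: "AE \<omega> in M. Y \<omega> = 1 \<or> Y \<omega> = 0"
    by (intro prob_Collect_eq_1[THEN iffD1]) auto
  have "emeasure (distr M borel Y) A = emeasure M {\<omega> \<in> space M. Y \<omega> \<in> A}"
    by (subst emeasure_distr) (auto intro!: arg_cong[where f = "emeasure M"])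
  also have "\<dots> = emeasure M ((if 1 \<in> A then {\<omega> \<in> space M. Y \<omega> = 1} else {})
        \<union> (if 0 \<in> A then {\<omega> \<in> space M. Y \<omega> = 0} else {}))"
    using ae by (intro emeasure_eq_AE) (auto elim!: eventually_mono)
  also have "\<dots> = ennreal ((if 1 \<in> A then p else 0) + (if 0 \<in> A then 1 - p else 0))"
    unfolding emeasure_eq_measure
    by (subst finite_measure_Union) (auto simp: Y1 Y0 simp del: ennreal_plus)
  also have "\<dots> = emeasure (measure_pmf (bernoulli_pmf p))
      ((if 1 \<in> A then {True} else {}) \<union> (if 0 \<in> A then {False} else {}))"
    using p by (auto simp: measure_pmf.emeasure_eq_measure measure_measure_pmf_finite)
  also have "(if 1 \<in> A then {True} else {}) \<union> (if 0 \<in> A then {False} else {})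
      = {b. of_bool b \<in> A}"
    by (auto simp: of_bool_def split: if_splits)
  also have "emeasure (measure_pmf (bernoulli_pmf p)) {b. of_bool b \<in> A}
      = emeasure (distr (measure_pmf (bernoulli_pmf p)) borel of_bool) A"
    by (subst emeasure_distr) (auto intro!: arg_cong[where f = "emeasure _"])
  finally show "emeasure (distr M borel Y) A
      = emeasure (distr (measure_pmf (bernoulli_pmf p)) borel of_bool) A" .
qed simp

lemma measure_sum_less:
  fixes Y :: "nat \<Rightarrow> 'a \<Rightarrow> real"
  assumes "prob_space M" and ind: "prob_space.indep_vars M (\<lambda>_. borel) Y {1..n}" and "n \<ge> 1"
  shows "measure M {\<omega> \<in> space M. (\<Sum>i=1..n. Y i \<omega>) < x}
    = measure (Pi\<^sub>M {1..n} (\<lambda>i. distr M borel (Y i)))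
        {f \<in> space (Pi\<^sub>M {1..n} (\<lambda>_. borel)). (\<Sum>i=1..n. f i) < x}"
proof -
  interpret prob_space M by fact
  have rv: "\<And>i. i \<in> {1..n} \<Longrightarrow> Y i \<in> borel_measurable M"
    using ind by (auto simp: indep_vars_def2)
  have [measurable]: "(\<lambda>\<omega>. \<lambda>i\<in>{1..n}. Y i \<omega>) \<in> measurable M (Pi\<^sub>M {1..n} (\<lambda>_. borel))"
    by (intro measurable_restrict rv)
  have eq: "Pi\<^sub>M {1..n} (\<lambda>i. distr M borel (Y i))
      = distr M (Pi\<^sub>M {1..n} (\<lambda>_. borel)) (\<lambda>\<omega>. \<lambda>i\<in>{1..n}. Y i \<omega>)"
    using ind rv \<open>n \<ge> 1\<close> by (subst (asm) indep_vars_iff_distr_eq_PiM') auto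
  show ?thesis
    unfolding eq
    by (subst measure_distr)
       (auto intro!: arg_cong[where f = prob] simp: space_PiM simp del: One_nat_def)
qed

lemma prob_space_bernoulli_space: "prob_space (bernoulli_space p)"
  unfolding bernoulli_space_def by (intro prob_space_PiM measure_pmf.prob_space_axioms)

lemma distr_bernoulli_rv:
  "distr (bernoulli_space p) borel (bernoulli_rv i)
    = distr (measure_pmf (bernoulli_pmf p)) borel of_bool"
proof -
  have "distr (bernoulli_space p) borel (bernoulli_rv i)
      = distr (distr (bernoulli_space p) (measure_pmf (bernoulli_pmf p)) (\<lambda>\<omega>. \<omega> i)) borel of_bool"
    unfolding bernoulli_space_def
    by (subst distr_distr) (auto simp: bernoulli_rv_def[abs_def] comp_def)
  also have "distr (bernoulli_space p) (measure_pmf (bernoulli_pmf p)) (\<lambda>\<omega>. \<omega> i)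
      = measure_pmf (bernoulli_pmf p)"
    unfolding bernoulli_space_def
    by (rule distr_PiM_component) (auto intro: measure_pmf.prob_space_axioms)
  finally show ?thesis .
qed

lemma indep_vars_bernoulli_rv:
  "prob_space.indep_vars (bernoulli_space p) (\<lambda>_. borel) bernoulli_rv UNIV"
proof -
  interpret prob_space "bernoulli_space p" by (rule prob_space_bernoulli_space)
  have comp: "distr (bernoulli_space p) (measure_pmf (bernoulli_pmf p)) (\<lambda>\<omega>. \<omega> i)
      = measure_pmf (bernoulli_pmf p)" for i
    unfolding bernoulli_space_def
    by (rule distr_PiM_component) (auto intro: measure_pmf.prob_space_axioms)
  have "distr (bernoulli_space p) (bernoulli_space p) (\<lambda>\<omega>. \<lambda>i\<in>UNIV. \<omega> i) = bernoulli_space p"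
    by (simp add: restrict_UNIV)
  then have "indep_vars (\<lambda>_. measure_pmf (bernoulli_pmf p)) (\<lambda>i \<omega>. \<omega> i) UNIV"
    by (subst indep_vars_iff_distr_eq_PiM')
       (auto simp: bernoulli_space_def comp[unfolded bernoulli_space_def])
  then have "indep_vars (\<lambda>_. borel) (\<lambda>i \<omega>. (of_bool (\<omega> i) :: real)) UNIV"
    by (rule indep_vars_compose2) auto
  then show ?thesis
    by (simp add: bernoulli_rv_def[abs_def])
qed

lemma sum_less_eq_F:
  fixes Y :: "nat \<Rightarrow> 'a \<Rightarrow> real"
  assumes M: "prob_space M" and p: "0 < p" "p < 1"
    and ind: "prob_space.indep_vars M (\<lambda>_. borel) Y {1..}"
    and Y1: "\<And>i. i \<ge> 1 \<Longrightarrow> measure M {\<omega> \<in> space M. Y i \<omega> = 1} = p"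
    and Y0: "\<And>i. i \<ge> 1 \<Longrightarrow> measure M {\<omega> \<in> space M. Y i \<omega> = 0} = 1 - p"
  shows "measure M {\<omega> \<in> space M. (\<Sum>i=1..n. Y i \<omega>) < x} = F n p x"
proof (cases "n \<ge> 1")
  case True
  have rv: "i \<ge> 1 \<Longrightarrow> Y i \<in> borel_measurable M" for i
    using ind by (auto simp: prob_space.indep_vars_def2[OF M])
  have "prob_space.indep_vars M (\<lambda>_. borel) Y {1..n}"
    by (rule prob_space.indep_vars_subset[OF M ind]) auto
  moreover have "prob_space.indep_vars (bernoulli_space p) (\<lambda>_. borel) bernoulli_rv {1..n}"
    by (rule prob_space.indep_vars_subset[OF prob_space_bernoulli_space indep_vars_bernoulli_rv])
       auto
  moreover have "Pi\<^sub>M {1..n} (\<lambda>i. distr M borel (Y i))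
      = Pi\<^sub>M {1..n} (\<lambda>i. distr (bernoulli_space p) borel (bernoulli_rv i))"
    unfolding distr_bernoulli_rv
    by (intro PiM_cong refl distr_eq_bernoulli M rv p Y1 Y0) auto
  ultimately show ?thesis
    using True unfolding F_def
    by (subst (1 2) measure_sum_less) (auto simp: M prob_space_bernoulli_space simp del: One_nat_def)
next
  case False
  then show ?thesis
    using prob_space.prob_space[OF M] prob_space.prob_space[OF prob_space_bernoulli_space[of p]]
    by (cases "0 < x") (auto simp: F_def)
qed

end

theory Submission
  imports Defs "HOL-Probability.Product_PMF" "HOL-Real_Asymp.Real_Asymp"
begin

text \<open>
  Fix n and k and regard (F - G)/\<rho> as a function of p, where F is taken at k or at k +
  1. By the mean value theorem it suffices that its derivative is bounded by L, that L
  decreases on (0, 1/2], and that the nearest node is at distance at most h/2; the maximum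
  of two absolute values inherits the Lipschitz bound.

  The derivative has two contributions. The derivative of 1/\<rho> is multiplied by F - G,
  which is at most 0.542 = 2 c3 in absolute value by Cantelli's inequality
  (F_minus_Phi_bound). The derivative of F telescopes to a multiple of one binomial
  probability b, and the derivative of \<Phi>(z), where z = (k - n p)/\<sigma> and
  \<sigma>^2 = n p (1 - p), is a multiple of \<phi>(z). Both grow like sqrt n, but their
  difference is governed by the local error E = \<sigma>^2 b - \<sigma> \<phi>(z): up to
  sign, p (1 - p) times the derivative of F - G is E k/(n p) + z \<phi>(z)/2, or the
  analogous expression for k + 1 (deriv_F_minus_G_bounds). Here |z \<phi>(z)|/2 \<le> 0.121
  = c2, and c1 = 0.516 is the bound for |E| (local_limit).

  The bound for E, a local limit theorem with rate 1/\<sigma>^2 and explicit constant, is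
  obtained without characteristic functions. For fixed n and k the error satisfies a linear
  differential equation in p (DERIV_local_err), in which the large terms k - n p of b and of
  the Gaussian density coincide. At the mode p = k/n Stirling's formula with an error term
  gives E (Bernstein_mode_stirling). Away from the mode either the monotonicity of
  b/\<phi>(z) in p bounds E, or the differential equation pushes E back towards 0 whenever
  |E| > 0.516 (le_of_pos_deriv_above). The true supremum of |E| is considerably smaller than
  0.516, so crude estimates suffice.

  That L decreases (L_antimono) is not obvious, since 1/((1 - 2u) sqrt u) with u = p (1 - p)
  increases near p = 1/2; the combination of the factors still has a derivative of constant
  sign.
\<close>

section \<open>Stirling's formula with an error term\<close>

text \<open>
  The logarithm of m! divided by the square root of m times (m / e)^m; Stirling's formula
  says that it converges to half of ln (2 \<pi>).
\<close>

definition stirling_log :: "nat \<Rightarrow> real" where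
  "stirling_log m = ln (fact m) - (real m + 1/2) * ln (real m) + real m"

lemma stirling_log_diff:
  assumes "m > 0"
  shows "stirling_log m - stirling_log (Suc m) = (real m + 1/2) * (ln (real m + 1) - ln (real m)) - 1"
proof -
  have "ln (fact (Suc m) :: real) = ln (real m + 1) + ln (fact m)"
    by (simp add: ln_mult add.commute del: of_nat_Suc flip: of_nat_Suc)
  then show ?thesis
    by (simp add: stirling_log_def algebra_simps)
qed

text \<open>
  The difference of consecutive terms is (m + 1/2) ln (1 + 1/m) - 1, so monotonicity is the
  midpoint-rule lower bound for the integral of 1/x over [m, m + 1].
\<close>

lemma stirling_log_Suc_le:
  assumes "m > 0"
  shows "stirling_log (Suc m) \<le> stirling_log m"
proof -
  have "ln (real m + 1) - ln (real m) \<ge> 2 * ((real m + 1) - real m) / (real m + (real m + 1))"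
    using assms by (intro ln_inverse_approx_ge) auto
  then have "(real m + 1/2) * (ln (real m + 1) - ln (real m)) \<ge> 1"
    by (simp add: field_simps)
  then show ?thesis using stirling_log_diff[OF assms] by simp
qed

text \<open>
  The trapezoidal rule bounds the same integral from above; its excess over the midpoint
  bound telescopes as 1/(4m) - 1/(4(m + 1)). The sharp constant 1/12 would need a finer
  quadrature, and 1/4 is enough for the local limit bound.
\<close>

lemma stirling_log_corrected_le_Suc:
  assumes "m > 0"
  shows "stirling_log m - 1 / (4 * real m) \<le> stirling_log (Suc m) - 1 / (4 * real (Suc m))"
proof -
  have "ln (real m + 1) - ln (real m) \<le> 1 * (inverse (real m) + inverse (real m + 1)) / 2"
    using assms by (intro ln_inverse_approx_le) auto
  then have "(real m + 1/2) * (ln (real m + 1) - ln (real m)) 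
      \<le> (real m + 1/2) * ((inverse (real m) + inverse (real m + 1)) / 2)"
    by (intro mult_left_mono) auto
  also have "\<dots> = 1 + (1 / (4 * real m) - 1 / (4 * real (Suc m)))"
    using assms by (simp add: divide_simps) (simp add: algebra_simps)
  finally show ?thesis using stirling_log_diff[OF assms] by simp
qed

lemma wallis_product_eq:
  "(\<Prod>k=1..n. (4 * real k ^ 2) / (4 * real k ^ 2 - 1))
     = 16 ^ n * fact n ^ 4 / (fact (2 * n) ^ 2 * (2 * real n + 1))"
proof (induction n)
  case 0
  then show ?case by simp
next
  case (Suc n)
  have f: "fact (2 * Suc n) = (2 * real n + 2) * (2 * real n + 1) * fact (2 * n)"
    by (simp add: algebra_simps)
  have g: "4 * real (Suc n) ^ 2 - 1 = (2 * real n + 1) * (2 * real n + 3)"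
    by (simp add: power2_eq_square algebra_simps)
  have nz: "2 * real n + 1 \<noteq> 0" "2 * real n + 3 \<noteq> 0" "real n + 1 \<noteq> 0" by linarith+
  have "(\<Prod>k=1..Suc n. (4 * real k ^ 2) / (4 * real k ^ 2 - 1))
    = 16 ^ n * fact n ^ 4 / (fact (2 * n) ^ 2 * (2 * real n + 1)) * 
       ((4 * real (Suc n) ^ 2) / (4 * real (Suc n) ^ 2 - 1))"
    using Suc by (simp add: mult.commute)
  also have "\<dots> = 16 ^ Suc n * ((real n + 1) * fact n) ^ 4 / 
      (((2 * real n + 2) * (2 * real n + 1) * fact (2 * n)) ^ 2 * (2 * real n + 3))"
    unfolding g using nz by (simp add: divide_simps) (simp add: power2_eq_square power4_eq_xxxx algebra_simps)
  also have "\<dots> = 16 ^ Suc n * fact (Suc n) ^ 4 / (fact (2 * Suc n) ^ 2 * (2 * real (Suc n) + 1))"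
    unfolding f by (simp add: algebra_simps)
  finally show ?case .
qed

text \<open>
  Monotonicity gives convergence. In the logarithm of the Wallis product the main terms
  cancel and leave 4 l - 2 l with l the limit, which determines l.
\<close>

lemma stirling_log_tendsto: "stirling_log \<longlonglongrightarrow> ln (2 * pi) / 2"
proof -
  have dec: "decseq (\<lambda>m. stirling_log (Suc m))"
    by (rule decseq_SucI) (rule stirling_log_Suc_le, simp)
  have inc: "incseq (\<lambda>m. stirling_log (Suc m) - 1 / (4 * real (Suc m)))"
    by (rule incseq_SucI) (rule stirling_log_corrected_le_Suc, simp)
  have bdd: "\<forall>m. stirling_log (Suc 0) - 1 / 4 \<le> stirling_log (Suc m)"
  proof
    fix m
    have "stirling_log (Suc 0) - 1 / 4 \<le> stirling_log (Suc m) - 1 / (4 * real (Suc m))"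
      using incseqD[OF inc, of 0 m] by simp
    moreover have "1 / (4 * real (Suc m)) \<ge> 0" by simp
    ultimately show "stirling_log (Suc 0) - 1 / 4 \<le> stirling_log (Suc m)" by linarith
  qed
  from decseq_convergent[OF dec bdd] obtain l where "(\<lambda>m. stirling_log (Suc m)) \<longlonglongrightarrow> l"
    by blast
  then have l: "stirling_log \<longlonglongrightarrow> l"
    by (rule LIMSEQ_imp_Suc)
  have l2: "(\<lambda>n. stirling_log (2 * n)) \<longlonglongrightarrow> l"
    using LIMSEQ_subseq_LIMSEQ[OF l, of "\<lambda>n. 2 * n"] by (simp add: strict_mono_def o_def)
  have eq: "ln (\<Prod>k=1..n. (4 * real k ^ 2) / (4 * real k ^ 2 - 1)) =
      4 * stirling_log n - 2 * stirling_log (2 * n) + ln (real n / (2 * (2 * real n + 1)))"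
    if "n > 0" for n
  proof -
    have "ln (\<Prod>k=1..n. (4 * real k ^ 2) / (4 * real k ^ 2 - 1)) =
      ln ((2::real) ^ (4 * n)) + ln (fact n ^ 4) - (ln (fact (2 * n) ^ 2) + ln (2 * real n + 1))"
      unfolding wallis_product_eq using that by (simp add: ln_div ln_mult power_mult add_pos_nonneg)
    also have "\<dots> = 4 * real n * ln 2 + 4 * ln (fact n) - 2 * ln (fact (2 * n)) - ln (2 * real n + 1)"
      by (simp add: ln_realpow)
    also have "\<dots> = 4 * stirling_log n - 2 * stirling_log (2 * n) 
        + (ln (real n) - (ln 2 + ln (2 * real n + 1)))"
      using that by (simp add: stirling_log_def ln_mult algebra_simps)
    also have "ln (real n) - (ln 2 + ln (2 * real n + 1)) = ln (real n / (2 * (2 * real n + 1)))"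
    proof -
      have "ln (real n / (2 * (2 * real n + 1))) = ln (real n) - ln (2 * (2 * real n + 1))"
        by (rule ln_divide_pos) (use that in auto)
      moreover have "ln (2 * (2 * real n + 1)) = ln 2 + ln (2 * real n + 1)"
        by (rule ln_mult_pos) auto
      ultimately show ?thesis by simp
    qed
    finally show ?thesis .
  qed
  have r: "(\<lambda>n. ln (real n / (2 * (2 * real n + 1)))) \<longlonglongrightarrow> ln (1 / 4)"
    by (intro tendsto_ln) (real_asymp, simp)
  have "(\<lambda>n. 4 * stirling_log n - 2 * stirling_log (2 * n) + ln (real n / (2 * (2 * real n + 1))))
          \<longlonglongrightarrow> 4 * l - 2 * l + ln (1 / 4)"
    by (intro tendsto_intros l l2 r)
  moreover have "(\<lambda>n. 4 * stirling_log n - 2 * stirling_log (2 * n) + ln (real n / (2 * (2 * real n + 1))))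
          \<longlonglongrightarrow> ln (pi / 2)"
  proof (rule Lim_transform_eventually[OF tendsto_ln[OF wallis]])
    show "\<forall>\<^sub>F n in sequentially. ln (\<Prod>k=1..n. (4 * real k ^ 2) / (4 * real k ^ 2 - 1)) =
      4 * stirling_log n - 2 * stirling_log (2 * n) + ln (real n / (2 * (2 * real n + 1)))"
      using eventually_gt_at_top[of 0] by eventually_elim (rule eq)
  qed simp
  ultimately have "4 * l - 2 * l + ln (1 / 4) = ln (pi / 2)"
    by (rule LIMSEQ_unique)
  moreover have "ln (pi / 2) - ln (1 / 4) = ln (2 * pi)"
    by (simp add: ln_div ln_mult) (use ln_realpow[of 2 2] in simp)
  ultimately have "l = ln (2 * pi) / 2"
    by simp
  with l show ?thesis by simp
qed

lemma stirling_log_antimono: "0 < k \<Longrightarrow> k \<le> n \<Longrightarrow> stirling_log n \<le> stirling_log k"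
  by (rule dec_induct[of k n]) (auto intro: order_trans[OF stirling_log_Suc_le])

lemma stirling_log_lower: "0 < m \<Longrightarrow> ln (2 * pi) / 2 \<le> stirling_log m"
  by (rule LIMSEQ_le_const2[OF stirling_log_tendsto]) (auto intro: stirling_log_antimono)

lemma stirling_log_upper:
  assumes "0 < m"
  shows "stirling_log m \<le> ln (2 * pi) / 2 + 1 / (4 * real m)"
proof -
  have "stirling_log m - 1 / (4 * real m) \<le> stirling_log n - 1 / (4 * real n)" if "m \<le> n" for n
    using that
  proof (induction n rule: dec_induct)
    case (step n)
    then show ?case using stirling_log_corrected_le_Suc[of n] assms by linarith
  qed simp
  moreover have "(\<lambda>n. stirling_log n - 1 / (4 * real n)) \<longlonglongrightarrow> ln (2 * pi) / 2 - 0"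
    by (intro tendsto_diff stirling_log_tendsto) real_asymp
  ultimately show ?thesis
    using LIMSEQ_le_const[of "\<lambda>n. stirling_log n - 1 / (4 * real n)" "ln (2 * pi) / 2"
        "stirling_log m - 1 / (4 * real m)"] by fastforce
qed

text \<open>
  At p = k/n the exponential factors of Stirling's formula cancel exactly, so the
  probability of k successes is the Gaussian density at its centre up to a relative error of
  order 1/v, where v is the variance.
\<close>

lemma Bernstein_mode_stirling:
  assumes "0 < k" "k < n"
  defines "v \<equiv> real k * real (n - k) / real n"
  shows "1 - 1 / (4 * v) \<le> sqrt (2 * pi * v) * Bernstein n k (real k / real n)"
    and "sqrt (2 * pi * v) * Bernstein n k (real k / real n) \<le> 1"
proof -
  define j where "j = n - k"
  have j: "0 < j" "real n = real k + real j" "n - k = j" using assms by (auto simp: j_def)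
  have v: "v > 0" using assms j by (simp add: v_def)
  let ?x = "sqrt (2 * pi * v) * Bernstein n k (real k / real n)"
  have q: "1 - real k / real n = real j / real n" using j assms by (simp add: field_simps)
  have pos: "Bernstein n k (real k / real n) > 0"
    using assms by (intro Bernstein_pos) (auto simp: field_simps)
  have ch: "real (n choose k) = fact n / (fact k * fact j)"
    using assms by (simp add: binomial_fact j_def)
  have "ln (Bernstein n k (real k / real n)) =
      ln (fact n) - ln (fact k) - ln (fact j) + real k * (ln (real k) - ln (real n)) 
        + real j * (ln (real j) - ln (real n))"
    unfolding Bernstein_def q ch j(3) using assms j(1) by (simp add: ln_mult ln_div ln_realpow)
  moreover have "ln (sqrt (2 * pi * v)) = ln (2 * pi) / 2 + (ln (real k) + ln (real j) - ln (real n)) / 2"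
    using assms(1,2) j(1) by (simp add: v_def j(3) ln_sqrt ln_mult ln_div add_divide_distrib diff_divide_distrib)
  ultimately have "ln ?x = stirling_log n - stirling_log k - stirling_log j + ln (2 * pi) / 2"
    using v pos by (simp add: ln_mult stirling_log_def j(2) algebra_simps add_divide_distrib diff_divide_distrib)
  then have lx: "?x = exp (stirling_log n - stirling_log k - stirling_log j + ln (2 * pi) / 2)"
    using v pos by (metis exp_ln mult_pos_pos pi_gt_zero real_sqrt_gt_zero zero_less_numeral)
  show "?x \<le> 1"
    unfolding lx using stirling_log_antimono[of k n] stirling_log_lower[of j] assms j by simp
  have "1 / (4 * v) = 1 / (4 * real k) + 1 / (4 * real j)"
    using assms(1) j unfolding v_def j(3) by (simp add: field_simps)
  then have "- (1 / (4 * v)) \<le> stirling_log n - stirling_log k - stirling_log j + ln (2 * pi) / 2"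
    using stirling_log_lower[of n] stirling_log_upper[of k] stirling_log_upper[of j] assms(1,2) j(1) by simp
  then have "1 + - (1 / (4 * v)) \<le> ?x"
    unfolding lx by (rule order_trans[OF exp_ge_add_one_self, OF exp_le_cancel_iff[THEN iffD2]])
  then show "1 - 1 / (4 * v) \<le> ?x" by simp
qed

section \<open>The binomial distribution function and its derivative\<close>

text \<open>
  The distribution function of the sum depends only on the joint law of the first n
  coordinates, so the infinite product space can be exchanged for the finite product of
  probability mass functions, for which the number of successes is known to be binomial.
\<close>

lemma F_eq_measure_binomial:
  assumes p: "0 < p" "p < 1" and n: "n \<ge> 1"
  shows "F n p x = measure (measure_pmf (binomial_pmf n p)) {j. real j < x}"
proof -
  let ?P = "Pi_pmf {1..n} False (\<lambda>_. bernoulli_pmf p)"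
  define Y :: "nat \<Rightarrow> (nat \<Rightarrow> bool) \<Rightarrow> real" where "Y = (\<lambda>i f. of_bool (f i))"
  have "prob_space.indep_vars (measure_pmf ?P) (\<lambda>_. count_space UNIV) (\<lambda>i f. f i) {1..n}"
    by (rule indep_vars_Pi_pmf) simp
  then have indep: "prob_space.indep_vars (measure_pmf ?P) (\<lambda>_. borel) Y {1..n}"
    unfolding Y_def
    by (rule prob_space.indep_vars_compose2[OF measure_pmf.prob_space_axioms]) simp
  have indep': "prob_space.indep_vars (bernoulli_space p) (\<lambda>_. borel) bernoulli_rv {1..n}"
    by (rule prob_space.indep_vars_subset[OF prob_space_bernoulli_space indep_vars_bernoulli_rv])
       auto
  have distr: "distr (measure_pmf ?P) borel (Y i) = distr (bernoulli_space p) borel (bernoulli_rv i)"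
    if "i \<in> {1..n}" for i
  proof -
    have "distr (measure_pmf ?P) borel (Y i)
        = distr (distr (measure_pmf ?P) (count_space UNIV) (\<lambda>f. f i)) borel of_bool"
      by (subst distr_distr) (auto simp: Y_def comp_def)
    also have "distr (measure_pmf ?P) (count_space UNIV) (\<lambda>f. f i) = measure_pmf (map_pmf (\<lambda>f. f i) ?P)"
      by (simp add: map_pmf_rep_eq)
    also have "map_pmf (\<lambda>f. f i) ?P = bernoulli_pmf p"
      using that by (subst Pi_pmf_component) auto
    finally show ?thesis
      by (simp add: distr_bernoulli_rv)
  qed
  have "F n p x = measure (measure_pmf ?P) {f \<in> space (measure_pmf ?P). (\<Sum>i=1..n. Y i f) < x}"
    unfolding F_def 
      measure_sum_less[OF prob_space_bernoulli_space indep' n]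
      measure_sum_less[OF measure_pmf.prob_space_axioms indep n]
    by (intro arg_cong2[where f = measure] PiM_cong refl) (simp_all add: distr[symmetric] del: One_nat_def)
  also have "\<dots> = measure (measure_pmf ?P) ((\<lambda>f. card {i \<in> {1..n}. f i}) -` {j. real j < x})"
    by (intro arg_cong2[where f = measure] refl) 
       (auto simp: Y_def of_bool_def sum.If_cases Int_def conj_commute)
  also have "\<dots> = measure (measure_pmf (map_pmf (\<lambda>f. card {i \<in> {1..n}. f i}) ?P)) {j. real j < x}"
    by simp
  also have "map_pmf (\<lambda>f. card {i \<in> {1..n}. f i}) ?P = binomial_pmf n p"
    using p by (intro binomial_pmf_altdef'[symmetric]) auto
  finally show ?thesis .
qed

lemma F_eq_sum_Bernstein:
  assumes p: "0 < p" "p < 1" and n: "n \<ge> 1"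
  shows "F n p (real k) = (\<Sum>j<k. Bernstein n j p)"
proof -
  have "F n p (real k) = measure (measure_pmf (binomial_pmf n p)) {..<k}"
    unfolding F_eq_measure_binomial[OF assms] by (intro arg_cong2[where f = measure]) auto
  also have "\<dots> = (\<Sum>j<k. pmf (binomial_pmf n p) j)"
    by (rule measure_measure_pmf_finite) simp
  also have "\<dots> = (\<Sum>j<k. Bernstein n j p)"
    using p by (intro sum.cong) (auto simp: Bernstein_def)
  finally show ?thesis .
qed

lemma Bernstein_Suc:
  assumes "0 < p" "p < 1" "k < n"
  shows "real (Suc k) * (1 - p) * Bernstein n (Suc k) p = real (n - k) * p * Bernstein n k p"
proof -
  have "n - k = Suc (n - Suc k)" using assms by simp
  then have q: "(1 - p) ^ (n - k) = (1 - p) * (1 - p) ^ (n - Suc k)" by simp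
  have "Suc k * (n choose Suc k) = (n - k) * (n choose k)"
    by (metis binomial_absorb_comp binomial_absorption)
  then have "real (Suc k) * real (n choose Suc k) = real (n - k) * real (n choose k)"
    by (metis of_nat_mult)
  then have "real (Suc k) * real (n choose Suc k) * (p ^ Suc k * (1 - p) * (1 - p) ^ (n - Suc k))
      = real (n - k) * real (n choose k) * (p ^ Suc k * (1 - p) * (1 - p) ^ (n - Suc k))"
    by (rule arg_cong)
  then show ?thesis
    unfolding Bernstein_def q by (simp only: power_Suc mult_ac)
qed

text \<open>
  The derivative is written through the logarithmic derivative (k - n p) / (p (1 - p)), the
  form that matches the derivative of the Gaussian density.
\<close>

lemma DERIV_Bernstein:
  assumes "0 < p" "p < 1" "k \<le> n"
  shows "(Bernstein n k has_real_derivative Bernstein n k p * (real k - real n * p) / (p * (1 - p))) (at p)"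
proof -
  have a: "real k * p ^ (k - 1) = real k * p ^ k / p"
    using assms by (cases k) auto
  have b: "real (n - k) * (1 - p) ^ (n - k - 1) = real (n - k) * (1 - p) ^ (n - k) / (1 - p)"
    using assms by (cases "n - k") auto
  have "((\<lambda>p. real (n choose k) * p ^ k * (1 - p) ^ (n - k)) has_real_derivative 
      real (n choose k) * ((real k * p ^ (k - 1)) * (1 - p) ^ (n - k) 
         - p ^ k * (real (n - k) * (1 - p) ^ (n - k - 1)))) (at p)"
    by (auto intro!: derivative_eq_intros simp: algebra_simps)
  also have "real (n choose k) * ((real k * p ^ (k - 1)) * (1 - p) ^ (n - k) 
         - p ^ k * (real (n - k) * (1 - p) ^ (n - k - 1))) =
      real (n choose k) * p ^ k * (1 - p) ^ (n - k) * (real k / p - real (n - k) / (1 - p))"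
    unfolding a b using assms by (simp add: field_simps)
  also have "real k / p - real (n - k) / (1 - p) = (real k - real n * p) / (p * (1 - p))"
    using assms by (simp add: field_simps of_nat_diff)
  finally show ?thesis by (simp add: Bernstein_def[abs_def])
qed

text \<open>
  The derivatives of the summands telescope: a shift of the success probability moves mass
  across the threshold k only through the single probability of k successes.
\<close>

lemma DERIV_sum_Bernstein:
  assumes p: "0 < p" "p < 1" and "k \<le> n"
  shows "((\<lambda>p. \<Sum>j<k. Bernstein n j p) has_real_derivative - (real k / p) * Bernstein n k p) (at p)"
  using \<open>k \<le> n\<close>
proof (induction k)
  case (Suc k)
  have "((\<lambda>p. (\<Sum>j<k. Bernstein n j p) + Bernstein n k p) has_real_derivative 
    - (real k / p) * Bernstein n k p + Bernstein n k p * (real k - real n * p) / (p * (1 - p))) (at p)"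
    using Suc p by (intro DERIV_add DERIV_Bernstein) auto
  moreover have "- (real k / p) * Bernstein n k p + Bernstein n k p * (real k - real n * p) / (p * (1 - p))
     = - ((real (n - k) * p * Bernstein n k p) / (p * (1 - p)))"
    using p Suc by (simp add: of_nat_diff divide_simps) (simp add: algebra_simps)
  moreover have "\<dots> = - (real (Suc k) / p) * Bernstein n (Suc k) p"
    unfolding Bernstein_Suc[OF p Suc_le_lessD[OF Suc.prems], symmetric] using p by (simp add: divide_simps)
  ultimately show ?case by simp
qed simp

lemma DERIV_sum_Bernstein_Suc:
  assumes p: "0 < p" "p < 1" and "k \<le> n"
  shows "((\<lambda>p. \<Sum>j<Suc k. Bernstein n j p) has_real_derivative 
           - (real (n - k) / (1 - p)) * Bernstein n k p) (at p)"
proof -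
  have "((\<lambda>p. (\<Sum>j<k. Bernstein n j p) + Bernstein n k p) has_real_derivative 
    - (real k / p) * Bernstein n k p + Bernstein n k p * (real k - real n * p) / (p * (1 - p))) (at p)"
    using assms by (intro DERIV_add DERIV_Bernstein DERIV_sum_Bernstein) auto
  moreover have "- (real k / p) * Bernstein n k p + Bernstein n k p * (real k - real n * p) / (p * (1 - p))
     = - (real (n - k) / (1 - p)) * Bernstein n k p"
    using assms by (simp add: of_nat_diff divide_simps) (simp add: algebra_simps)
  ultimately show ?thesis by simp
qed

section \<open>The normal distribution function and density\<close>

lemma Phi_diff:
  assumes "a \<le> b"
  shows "(std_normal_density has_integral Phi b - Phi a) {a..b}"
proof -
  interpret real_distribution std_normal_distribution by (rule real_dist_normal_dist)
  have i: "integrable lborel (\<lambda>x. std_normal_density x * indicator {a<..b} x)"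
    by (intro integrable_real_mult_indicator) auto
  have "Phi b - Phi a = measure std_normal_distribution {a<..b}"
  proof (cases "a < b")
    case True
    then show ?thesis by (simp add: Phi_def cdf_diff_eq)
  qed (use assms in auto)
  also have "\<dots> = (LINT x|lborel. std_normal_density x * indicator {a<..b} x)"
  proof -
    have "emeasure std_normal_distribution {a<..b}
        = (\<integral>\<^sup>+x. ennreal (std_normal_density x * indicator {a<..b} x) \<partial>lborel)"
      by (subst emeasure_density) (auto intro!: nn_integral_cong split: split_indicator)
    also have "\<dots> = ennreal (LINT x|lborel. std_normal_density x * indicator {a<..b} x)"
      by (intro nn_integral_eq_integral i AE_I2) simp
    finally show ?thesis
      by (simp add: measure_def)
  qed
  finally have e: "Phi b - Phi a = (LINT x|lborel. std_normal_density x * indicator {a<..b} x)" .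
  have "((\<lambda>x. std_normal_density x * indicator {a<..b} x) has_integral (Phi b - Phi a)) UNIV"
    unfolding e by (rule has_integral_integral_lborel[OF i])
  then have "((\<lambda>x. if x \<in> {a<..b} then std_normal_density x else 0) has_integral (Phi b - Phi a)) UNIV"
    by (rule has_integral_eq[rotated]) auto
  then have "(std_normal_density has_integral (Phi b - Phi a)) {a<..b}"
    by (simp only: has_integral_restrict_UNIV)
  moreover have "(std_normal_density has_integral (Phi b - Phi a)) {a<..b}
      \<longleftrightarrow> (std_normal_density has_integral (Phi b - Phi a)) {a..b}"
    by (rule has_integral_spike_set_eq) (auto intro: negligible_subset[of "{a}"])
  ultimately show ?thesis by simp
qed

lemma DERIV_Phi: "(Phi has_real_derivative std_normal_density x) (at x)"
proof -
  have cont: "continuous_on A std_normal_density" for A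
    unfolding std_normal_density_def by (intro continuous_intros) auto
  have "((\<lambda>u. integral {x - 1..u} std_normal_density) has_real_derivative std_normal_density x)
     (at x within {x - 1..x + 1})"
    by (rule integral_has_real_derivative) (auto intro: cont)
  then have "((\<lambda>u. integral {x - 1..u} std_normal_density) has_real_derivative std_normal_density x) (at x)"
    by (subst (asm) at_within_Icc_at) auto
  then have "((\<lambda>u. Phi (x - 1) + integral {x - 1..u} std_normal_density) 
      has_real_derivative std_normal_density x) (at x)"
    by (rule DERIV_cong[OF DERIV_add[OF DERIV_const]]) simp
  then show ?thesis
  proof (rule has_field_derivative_transform_within_open)
    show "open {x - 1<..}" by simp
    fix y assume "y \<in> {x - 1<..}"
    then show "Phi (x - 1) + integral {x - 1..y} std_normal_density = Phi y"
      using integral_unique[OF Phi_diff[of "x - 1" y]] by simp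
  qed simp
qed

text \<open>
  The sum of both values has derivative 0, and its limit at infinity is 1.
\<close>

lemma Phi_minus: "Phi (- x) = 1 - Phi x"
proof -
  have "((\<lambda>x. Phi x + Phi (- x)) has_real_derivative 0) (at x)" for x
  proof -
    have "((\<lambda>x. Phi x + Phi (- x)) has_real_derivative 
       std_normal_density x + std_normal_density (- x) * (- 1)) (at x)"
      by (intro DERIV_add DERIV_Phi DERIV_chain2[OF DERIV_Phi]) (auto intro!: derivative_eq_intros)
    then show ?thesis by (simp add: std_normal_density_def)
  qed
  then have const: "Phi x + Phi (- x) = Phi y + Phi (- y)" for x y
    by (intro DERIV_isconst_all) auto
  interpret real_distribution std_normal_distribution by (rule real_dist_normal_dist)
  have "((\<lambda>y. Phi y + Phi (- y)) \<longlongrightarrow> 1 + 0) at_top"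
    unfolding Phi_def
    by (intro tendsto_add cdf_lim_at_top_prob filterlim_compose[OF cdf_lim_at_bot] filterlim_uminus_at_bot_at_top)
  moreover have "((\<lambda>y. Phi y + Phi (- y)) \<longlongrightarrow> Phi x + Phi (- x)) at_top"
    by (subst const[of _ x]) (rule tendsto_const)
  ultimately have "1 + 0 = Phi x + Phi (- x)"
    by (rule tendsto_unique[OF trivial_limit_at_top_linorder])
  then show ?thesis by simp
qed

lemma exp_1_lower: "27182 / 10000 \<le> exp (1::real)"
proof -
  \<comment> \<open>Nine Taylor terms already give 2.71827...\<close>
  obtain t where "exp (1::real) = (\<Sum>m<9. 1 ^ m / fact m) + exp t / fact 9 * 1 ^ 9"
    using Maclaurin_exp_le[of 1 9] by blast
  moreover have "exp t / fact 9 * 1 ^ 9 \<ge> 0" by simp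
  moreover have "(\<Sum>m<9. (1::real) ^ m / fact m) \<ge> 27182 / 10000"
    by (simp add: lessThan_nat_numeral fact_numeral)
  ultimately show ?thesis by linarith
qed

lemma std_normal_density_le: "std_normal_density x \<le> 399 / 1000 * exp (- (x\<^sup>2 / 2))"
proof -
  have "1 / (399 / 1000) \<le> sqrt (2 * pi)"
    using pi_approx by (intro real_le_rsqrt) (simp add: power2_eq_square)
  then have "1 / sqrt (2 * pi) \<le> 399 / 1000"
    by (simp add: field_simps)
  then have "1 / sqrt (2 * pi) * exp (- (x\<^sup>2 / 2)) \<le> 399 / 1000 * exp (- (x\<^sup>2 / 2))"
    by (rule mult_right_mono) simp
  then show ?thesis
    by (simp only: std_normal_density_def minus_divide_left)
qed

lemma std_normal_density_bounded: "std_normal_density x \<le> 399 / 1000"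
  by (rule order_trans[OF std_normal_density_le]) simp

text \<open>
  The maximum of x \<phi>(x) is attained at x = 1 and equals 1 / sqrt (2 \<pi> e) =
  0.24197... Half of the bound is the constant 0.121 in L.
\<close>

lemma abs_mult_std_normal_density_le: "\<bar>x\<bar> * std_normal_density x \<le> 242 / 1000"
proof (rule power2_le_imp_le)
  have "x\<^sup>2 \<le> exp (x\<^sup>2 - 1)"
    using exp_ge_add_one_self[of "x\<^sup>2 - 1"] by simp
  then have "x\<^sup>2 * exp (- x\<^sup>2) \<le> exp (x\<^sup>2 - 1) * exp (- x\<^sup>2)"
    by (intro mult_right_mono) auto
  also have "\<dots> = 1 / exp 1"
    by (simp add: exp_diff exp_minus field_simps)
  finally have a: "x\<^sup>2 * exp (- x\<^sup>2) \<le> 1 / exp 1" .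
  have "31415 / 10000 * (27182 / 10000) \<le> pi * exp 1"
    using pi_approx exp_1_lower by (intro mult_mono) auto
  then have b: "1 / (2 * pi * exp 1) \<le> (242 / 1000)\<^sup>2"
    by (simp add: field_simps power2_eq_square)
  have "(\<bar>x\<bar> * std_normal_density x)\<^sup>2 = (x\<^sup>2 * exp (- x\<^sup>2)) / (2 * pi)"
    by (simp add: std_normal_density_def power_mult_distrib power_divide flip: exp_of_nat_mult)
  also have "\<dots> \<le> (1 / exp 1) / (2 * pi)"
    using a by (intro divide_right_mono) auto
  also have "\<dots> \<le> (242 / 1000)\<^sup>2" using b by (simp add: mult.commute)
  finally show "(\<bar>x\<bar> * std_normal_density x)\<^sup>2 \<le> (242 / 1000)\<^sup>2" .
qed simp

lemma DERIV_std_normal_density: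
  "(std_normal_density has_real_derivative - x * std_normal_density x) (at x)"
proof -
  define c where "c = 1 / sqrt (2 * pi)"
  have "std_normal_density = (\<lambda>x. c * exp (- x\<^sup>2 / 2))"
    by (auto simp: std_normal_density_def c_def)
  then show ?thesis
    by (auto intro!: derivative_eq_intros)
qed

section \<open>Differential equations for the local error\<close>

definition bin_sd :: "nat \<Rightarrow> real \<Rightarrow> real" where
  "bin_sd n p = sqrt (real n * p * (1 - p))"

definition bin_z :: "nat \<Rightarrow> nat \<Rightarrow> real \<Rightarrow> real" where
  "bin_z n k p = (real k - real n * p) / bin_sd n p"

text \<open>
  The error of the local limit theorem, scaled by the variance: it equals \<sigma>^2 times
  the difference between the probability of k successes and the approximating density
  \<phi>(z)/\<sigma>.
\<close>

definition local_err :: "nat \<Rightarrow> nat \<Rightarrow> real \<Rightarrow> real" where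
  "local_err n k p = (bin_sd n p)\<^sup>2 * Bernstein n k p - bin_sd n p * std_normal_density (bin_z n k p)"

lemma bin_sd_pos: "0 < n \<Longrightarrow> 0 < p \<Longrightarrow> p < 1 \<Longrightarrow> 0 < bin_sd n p"
  by (simp add: bin_sd_def)

lemma bin_sd_square: "0 \<le> p \<Longrightarrow> p \<le> 1 \<Longrightarrow> (bin_sd n p)\<^sup>2 = real n * p * (1 - p)"
  by (simp add: bin_sd_def)

lemma bin_z_mult_sd: "0 < n \<Longrightarrow> 0 < p \<Longrightarrow> p < 1 \<Longrightarrow> bin_z n k p * bin_sd n p = real k - real n * p"
  using bin_sd_pos[of n p] by (simp add: bin_z_def)

context
  fixes n k :: nat and p :: real
  assumes n: "0 < n" and p: "0 < p" "p < 1"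
begin

lemma DERIV_bin_sd:
  "(bin_sd n has_real_derivative bin_sd n p * ((1 - 2 * p) / 2) / (p * (1 - p))) (at p)"
proof -
  have pos: "0 < real n * p * (1 - p)" using n p by simp
  have s: "sqrt (real n * p * (1 - p)) * sqrt (real n * p * (1 - p)) = real n * p * (1 - p)"
    using pos by simp
  have "((\<lambda>p. sqrt (real n * p * (1 - p))) has_real_derivative 
      inverse (sqrt (real n * p * (1 - p))) / 2 * (real n * (1 - 2 * p))) (at p)"
    by (rule DERIV_chain2[where f = sqrt and g = "\<lambda>p. real n * p * (1 - p)", OF DERIV_real_sqrt[OF pos]])
       (auto intro!: derivative_eq_intros simp: algebra_simps)
  moreover have "inverse (sqrt (real n * p * (1 - p))) / 2 * (real n * (1 - 2 * p))
      = sqrt (real n * p * (1 - p)) * ((1 - 2 * p) / 2) / (p * (1 - p))"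
  proof -
    define S where "S = sqrt (real n * p * (1 - p))"
    have "S > 0" and n_eq: "real n = S * S / (p * (1 - p))"
      using pos p n unfolding S_def s by auto
    have "inverse S / 2 * (real n * (1 - 2 * p)) = S * ((1 - 2 * p) / 2) / (p * (1 - p))"
      using \<open>S > 0\<close> by (subst n_eq) (simp add: divide_simps)
    then show ?thesis
      by (simp only: S_def)
  qed
  ultimately show ?thesis
    by (simp only: bin_sd_def[abs_def])
qed

lemma DERIV_bin_z:
  "(bin_z n k has_real_derivative 
     - (bin_sd n p + bin_z n k p * (1 - 2 * p) / 2) / (p * (1 - p))) (at p)"
proof -
  have s: "bin_sd n p > 0" using n p by (rule bin_sd_pos)
  have sq: "real n = bin_sd n p * bin_sd n p / (p * (1 - p))"
    using p bin_sd_square[of p n] by (simp add: power2_eq_square)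
  have "((\<lambda>p. (real k - real n * p) / bin_sd n p) has_real_derivative
      ((- real n) * bin_sd n p - (real k - real n * p) * (bin_sd n p * ((1 - 2 * p) / 2) / (p * (1 - p)))) 
        / (bin_sd n p * bin_sd n p)) (at p)"
    using s by (intro DERIV_divide DERIV_bin_sd) (auto intro!: derivative_eq_intros)
  moreover have "((- real n) * bin_sd n p - (real k - real n * p) * (bin_sd n p * ((1 - 2 * p) / 2) / (p * (1 - p)))) 
        / (bin_sd n p * bin_sd n p) = - (bin_sd n p + bin_z n k p * (1 - 2 * p) / 2) / (p * (1 - p))"
  proof -
    define D where "D = real k - real n * p"
    have "((- real n) * bin_sd n p - D * (bin_sd n p * ((1 - 2 * p) / 2) / (p * (1 - p)))) 
        / (bin_sd n p * bin_sd n p) = - (bin_sd n p + D / bin_sd n p * (1 - 2 * p) / 2) / (p * (1 - p))"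
      using s p by (subst sq) (simp add: divide_simps, simp add: algebra_simps)
    then show ?thesis by (simp add: D_def bin_z_def)
  qed
  ultimately show ?thesis by (simp add: bin_z_def[abs_def])
qed

text \<open>
  The logarithmic derivative of \<sigma> \<phi>(z) agrees with that of the binomial
  probability, k - n p over p (1 - p), up to a term of lower order in \<sigma>. This
  cancellation is what makes the differential equation for the local error useful.
\<close>

lemma DERIV_density_bin_z:
  "((\<lambda>p. bin_sd n p * std_normal_density (bin_z n k p)) has_real_derivative 
     bin_sd n p * std_normal_density (bin_z n k p) 
       * (real k - real n * p + (1 - 2 * p) * (1 + (bin_z n k p)\<^sup>2) / 2) / (p * (1 - p))) (at p)"
proof -
  have "((\<lambda>p. bin_sd n p * std_normal_density (bin_z n k p)) has_real_derivative 
      bin_sd n p * ((1 - 2 * p) / 2) / (p * (1 - p)) * std_normal_density (bin_z n k p)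
     + - bin_z n k p * std_normal_density (bin_z n k p) * 
        (- (bin_sd n p + bin_z n k p * (1 - 2 * p) / 2) / (p * (1 - p))) * bin_sd n p) (at p)"
    by (rule DERIV_mult[OF DERIV_bin_sd DERIV_chain2[OF DERIV_std_normal_density DERIV_bin_z]])
  then show ?thesis
    unfolding bin_z_mult_sd[OF n p, symmetric]
    by (rule DERIV_cong)
       (simp add: add_divide_distrib diff_divide_distrib algebra_simps power2_eq_square)
qed

text \<open>
  A linear differential equation in p with n and k fixed. For p below the mode k/n the
  coefficient k - n p is positive, so moving away from the mode damps the error; the other
  term of the numerator is bounded by a multiple of \<sigma>.
\<close>

lemma DERIV_local_err:
  assumes "k \<le> n"
  shows "(local_err n k has_real_derivative 
     (local_err n k p * (real k - real n * p + (1 - 2 * p)) 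
        + bin_sd n p * std_normal_density (bin_z n k p) * (1 - 2 * p) * (1 - (bin_z n k p)\<^sup>2) / 2) 
      / (p * (1 - p))) (at p)"
proof -
  have "((\<lambda>p. (bin_sd n p)\<^sup>2 * Bernstein n k p 
           - bin_sd n p * std_normal_density (bin_z n k p)) has_real_derivative 
     (2 * (bin_sd n p * ((1 - 2 * p) / 2) / (p * (1 - p))) * bin_sd n p * Bernstein n k p
       + Bernstein n k p * (real k - real n * p) / (p * (1 - p)) * (bin_sd n p)\<^sup>2)
     - bin_sd n p * std_normal_density (bin_z n k p) 
       * (real k - real n * p + (1 - 2 * p) * (1 + (bin_z n k p)\<^sup>2) / 2) / (p * (1 - p))) (at p)"
    by (intro DERIV_diff DERIV_density_bin_z DERIV_mult DERIV_Bernstein p assms)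
       (auto intro!: derivative_eq_intros DERIV_bin_sd)
  then have "((\<lambda>p. (bin_sd n p)\<^sup>2 * Bernstein n k p 
           - bin_sd n p * std_normal_density (bin_z n k p)) has_real_derivative 
      (local_err n k p * (real k - real n * p + (1 - 2 * p)) 
        + bin_sd n p * std_normal_density (bin_z n k p) * (1 - 2 * p) * (1 - (bin_z n k p)\<^sup>2) / 2) 
      / (p * (1 - p))) (at p)"
  proof (rule DERIV_cong)
    define x where "x = std_normal_density (bin_z n k p)"
    define d where "d = real k - real n * p"
    have "(2 * (bin_sd n p * ((1 - 2 * p) / 2) / (p * (1 - p))) * bin_sd n p * Bernstein n k p
       + Bernstein n k p * d / (p * (1 - p)) * (bin_sd n p)\<^sup>2)
     - bin_sd n p * x * (d + (1 - 2 * p) * (1 + (bin_z n k p)\<^sup>2) / 2) / (p * (1 - p))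
      = ((2 * (bin_sd n p * ((1 - 2 * p) / 2)) * bin_sd n p * Bernstein n k p
       + Bernstein n k p * d * (bin_sd n p)\<^sup>2)
     - bin_sd n p * x * (d + (1 - 2 * p) * (1 + (bin_z n k p)\<^sup>2) / 2)) / (p * (1 - p))"
      by (simp add: add_divide_distrib diff_divide_distrib)
    also have "\<dots> = (((bin_sd n p)\<^sup>2 * Bernstein n k p - bin_sd n p * x) * (d + (1 - 2 * p)) 
        + bin_sd n p * x * (1 - 2 * p) * (1 - (bin_z n k p)\<^sup>2) / 2) / (p * (1 - p))"
      by (rule arg_cong[where f = "\<lambda>x. x / (p * (1 - p))"]) (simp add: power2_eq_square field_simps)
    finally show "(2 * (bin_sd n p * ((1 - 2 * p) / 2) / (p * (1 - p))) * bin_sd n p * Bernstein n k p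
       + Bernstein n k p * (real k - real n * p) / (p * (1 - p)) * (bin_sd n p)\<^sup>2)
     - bin_sd n p * std_normal_density (bin_z n k p) 
       * (real k - real n * p + (1 - 2 * p) * (1 + (bin_z n k p)\<^sup>2) / 2) / (p * (1 - p))
     = (local_err n k p * (real k - real n * p + (1 - 2 * p)) 
        + bin_sd n p * std_normal_density (bin_z n k p) * (1 - 2 * p) * (1 - (bin_z n k p)\<^sup>2) / 2) 
      / (p * (1 - p))"
      unfolding local_err_def x_def d_def .
  qed
  then show ?thesis
    by (simp add: local_err_def[abs_def])
qed

text \<open>
  Up to the constant sqrt (2 \<pi>) this function is the ratio of the binomial probability
  to \<phi>(z). Its derivative has the sign of 2 p - 1, which yields one-sided estimates of
  the error without any integration.
\<close>

lemma DERIV_Bernstein_exp: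
  assumes "k \<le> n"
  shows "((\<lambda>p. Bernstein n k p * exp ((bin_z n k p)\<^sup>2 / 2)) has_real_derivative 
     - (Bernstein n k p * exp ((bin_z n k p)\<^sup>2 / 2)) * ((1 - 2 * p) * (bin_z n k p)\<^sup>2 / 2) / (p * (1 - p))) (at p)"
proof -
  have "((\<lambda>p. Bernstein n k p * exp ((bin_z n k p)\<^sup>2 / 2)) has_real_derivative 
     Bernstein n k p * (real k - real n * p) / (p * (1 - p)) * exp ((bin_z n k p)\<^sup>2 / 2)
     + exp ((bin_z n k p)\<^sup>2 / 2) * (bin_z n k p * 
        (- (bin_sd n p + bin_z n k p * (1 - 2 * p) / 2) / (p * (1 - p)))) * Bernstein n k p) (at p)"
    by (intro DERIV_mult DERIV_Bernstein p assms DERIV_chain2[OF DERIV_exp])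
       (auto intro!: derivative_eq_intros DERIV_bin_z)
  then show ?thesis
    unfolding bin_z_mult_sd[OF n p, symmetric]
    by (rule DERIV_cong)
       (simp add: add_divide_distrib diff_divide_distrib algebra_simps power2_eq_square)
qed

text \<open>
  With the additional factor \<sigma> the function is, up to a constant, the ratio of the
  binomial probability to its approximation. For p at most 1/2 it increases as long as |z|
  is at most 1.
\<close>

lemma DERIV_sd_Bernstein_exp:
  assumes "k \<le> n"
  shows "((\<lambda>p. bin_sd n p * (Bernstein n k p * exp ((bin_z n k p)\<^sup>2 / 2))) has_real_derivative 
     (bin_sd n p * (Bernstein n k p * exp ((bin_z n k p)\<^sup>2 / 2))) 
       * ((1 - 2 * p) * (1 - (bin_z n k p)\<^sup>2) / 2) / (p * (1 - p))) (at p)"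
  by (rule DERIV_cong[OF DERIV_mult[OF DERIV_bin_sd DERIV_Bernstein_exp[OF assms]]])
     (simp add: add_divide_distrib diff_divide_distrib algebra_simps power2_eq_square)

end

section \<open>Barrier arguments\<close>

text \<open>
  A barrier argument: a function that increases wherever it exceeds C, and ends below C, was
  never above C, because a maximum above C would have a larger neighbour on its right.
\<close>

lemma le_of_pos_deriv_above:
  fixes f :: "real \<Rightarrow> real"
  assumes "a \<le> b" and cont: "continuous_on {a..b} f" and b: "f b \<le> C"
    and deriv: "\<And>s. a \<le> s \<Longrightarrow> s < b \<Longrightarrow> C < f s \<Longrightarrow> \<exists>D>0. (f has_real_derivative D) (at s)"
  shows "f a \<le> C"
proof -
  obtain s where s: "s \<in> {a..b}" "\<And>t. t \<in> {a..b} \<Longrightarrow> f t \<le> f s"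
    using continuous_attains_sup[OF compact_Icc _ cont] \<open>a \<le> b\<close> by auto
  have "f s \<le> C"
  proof (rule ccontr)
    assume "\<not> f s \<le> C"
    then have "C < f s" "s < b" using b s(1) by (auto simp: order_less_le)
    then obtain D where "D > 0" "(f has_real_derivative D) (at s)" using deriv[of s] s(1) by auto
    from DERIV_pos_inc_right[OF this(2,1)] obtain e where 
      e: "e > 0" "\<And>h. 0 < h \<Longrightarrow> h < e \<Longrightarrow> f s < f (s + h)" by auto
    define h where "h = min (e / 2) (b - s)"
    have "0 < h" "h < e" "s + h \<in> {a..b}" using e(1) \<open>s < b\<close> s(1) by (auto simp: h_def min_def)
    with e(2)[of h] s(2)[of "s + h"] show False by simp
  qed
  with s(2)[of a] \<open>a \<le> b\<close> show ?thesis by simp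
qed

lemma le_of_neg_deriv_above:
  fixes f :: "real \<Rightarrow> real"
  assumes "a \<le> b" and cont: "continuous_on {a..b} f" and a: "f a \<le> C"
    and deriv: "\<And>s. a < s \<Longrightarrow> s \<le> b \<Longrightarrow> C < f s \<Longrightarrow> \<exists>D<0. (f has_real_derivative D) (at s)"
  shows "f b \<le> C"
proof -
  have "(f \<circ> uminus) (- b) \<le> C"
  proof (rule le_of_pos_deriv_above[where f = "f \<circ> uminus" and a = "- b" and b = "- a"])
    show "- b \<le> - a" "(f \<circ> uminus) (- a) \<le> C" using assms(1) a by auto
    show "continuous_on {- b..- a} (f \<circ> uminus)"
      by (rule continuous_on_compose) (auto intro: continuous_intros cont)
    fix s assume s: "- b \<le> s" "s < - a" "C < (f \<circ> uminus) s"
    then obtain D where D: "D < 0" "(f has_real_derivative D) (at (- s))" 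
      using deriv[of "- s"] by auto
    then have "((f \<circ> uminus) has_real_derivative D * (- 1)) (at s)"
      unfolding o_def by (intro DERIV_chain2[where f = f]) (auto intro!: derivative_eq_intros)
    with D(1) show "\<exists>D>0. ((f \<circ> uminus) has_real_derivative D) (at s)"
      by (intro exI[of _ "- D"]) auto
  qed
  then show ?thesis by simp
qed

section \<open>The local limit theorem with a mode at most 1/2\<close>

lemma continuous_on_local_err:
  assumes "0 < n" "k \<le> n" "0 < a" "b < 1"
  shows "continuous_on {a..b} (local_err n k)"
  by (rule DERIV_continuous_on[OF has_field_derivative_at_within[OF DERIV_local_err]]) (use assms in auto)

text \<open>
  The factored form in which the bounds for the ratio of b to \<phi>(z) can be inserted.
\<close>

lemma local_err_eq:
  "local_err n k p = std_normal_density (bin_z n k p) * 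
     (sqrt (2 * pi) * (bin_sd n p)\<^sup>2 * (Bernstein n k p * exp ((bin_z n k p)\<^sup>2 / 2)) - bin_sd n p)"
proof -
  have "std_normal_density (bin_z n k p) * (sqrt (2 * pi) * exp ((bin_z n k p)\<^sup>2 / 2)) = 1"
    by (simp add: std_normal_density_def mult_exp_exp)
  then have "(bin_sd n p)\<^sup>2 * Bernstein n k p = (bin_sd n p)\<^sup>2 * Bernstein n k p *
      (std_normal_density (bin_z n k p) * (sqrt (2 * pi) * exp ((bin_z n k p)\<^sup>2 / 2)))"
    by simp
  then show ?thesis
    unfolding local_err_def by (simp only: algebra_simps)
qed

lemma Bernstein_exp_antimono:
  assumes "0 < n" "k \<le> n" "0 < a" "a \<le> b" "b \<le> 1 / 2"
  shows "Bernstein n k b * exp ((bin_z n k b)\<^sup>2 / 2) \<le> Bernstein n k a * exp ((bin_z n k a)\<^sup>2 / 2)"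
proof (rule DERIV_nonpos_imp_nonincreasing[OF \<open>a \<le> b\<close>])
  fix x assume x: "a \<le> x" "x \<le> b"
  let ?Q = "Bernstein n k x * exp ((bin_z n k x)\<^sup>2 / 2)"
  have "?Q * ((1 - 2 * x) * (bin_z n k x)\<^sup>2 / 2) / (x * (1 - x)) \<ge> 0"
    using x assms by (intro divide_nonneg_pos mult_nonneg_nonneg) (auto intro: Bernstein_nonneg)
  then have "- ?Q * ((1 - 2 * x) * (bin_z n k x)\<^sup>2 / 2) / (x * (1 - x)) \<le> 0"
    by simp
  moreover have "((\<lambda>p. Bernstein n k p * exp ((bin_z n k p)\<^sup>2 / 2)) has_real_derivative 
     - ?Q * ((1 - 2 * x) * (bin_z n k x)\<^sup>2 / 2) / (x * (1 - x))) (at x)"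
    using x assms by (intro DERIV_Bernstein_exp) auto
  ultimately show "\<exists>y. ((\<lambda>p. Bernstein n k p * exp ((bin_z n k p)\<^sup>2 / 2)) has_real_derivative y) (at x) \<and> y \<le> 0"
    by blast
qed

lemma sd_Bernstein_exp_mono:
  assumes "0 < n" "k \<le> n" "0 < a" "a \<le> b" "b \<le> 1 / 2"
    and z: "\<And>x. a \<le> x \<Longrightarrow> x \<le> b \<Longrightarrow> (bin_z n k x)\<^sup>2 \<le> 1"
  shows "bin_sd n a * (Bernstein n k a * exp ((bin_z n k a)\<^sup>2 / 2)) 
       \<le> bin_sd n b * (Bernstein n k b * exp ((bin_z n k b)\<^sup>2 / 2))"
proof (rule DERIV_nonneg_imp_nondecreasing[OF \<open>a \<le> b\<close>])
  fix x assume x: "a \<le> x" "x \<le> b"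
  let ?Q = "bin_sd n x * (Bernstein n k x * exp ((bin_z n k x)\<^sup>2 / 2))"
  have "?Q * ((1 - 2 * x) * (1 - (bin_z n k x)\<^sup>2) / 2) / (x * (1 - x)) \<ge> 0"
    using x assms z[of x] less_imp_le[OF bin_sd_pos[of n x]] 
    by (intro divide_nonneg_pos mult_nonneg_nonneg) (auto intro: Bernstein_nonneg)
  moreover have "((\<lambda>p. bin_sd n p * (Bernstein n k p * exp ((bin_z n k p)\<^sup>2 / 2))) has_real_derivative 
     ?Q * ((1 - 2 * x) * (1 - (bin_z n k x)\<^sup>2) / 2) / (x * (1 - x))) (at x)"
    using x assms by (intro DERIV_sd_Bernstein_exp) auto
  ultimately show "\<exists>y. ((\<lambda>p. bin_sd n p * (Bernstein n k p * exp ((bin_z n k p)\<^sup>2 / 2))) has_real_derivative y) (at x) \<and> 0 \<le> y"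
    by blast
qed

lemma bin_sd_square_diff:
  assumes "0 < p" "p < 1" "0 < p'" "p' < 1"
  shows "(bin_sd n p')\<^sup>2 - (bin_sd n p)\<^sup>2 = real n * (p' - p) * (1 - p - p')"
  using assms by (simp add: bin_sd_square algebra_simps)

lemma bin_z_mode: "0 < n \<Longrightarrow> bin_z n k (real k / real n) = 0"
  by (simp add: bin_z_def)

lemma bin_sd_mode:
  assumes "k \<le> n" "0 < n"
  shows "(bin_sd n (real k / real n))\<^sup>2 = real k * real (n - k) / real n"
  using assms by (subst bin_sd_square) (auto simp: field_simps of_nat_diff)

text \<open>
  For 1 \<le> k \<le> n/2 the variance k (n - k)/n at the mode is at least 1/2, which keeps
  the error term of Stirling's formula bounded.
\<close>

lemma mode_bounds:
  assumes k: "0 < k" "2 * k \<le> n"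
  defines "s0 \<equiv> bin_sd n (real k / real n)"
  defines "b0 \<equiv> Bernstein n k (real k / real n)"
  shows "1 - 1 / (4 * s0\<^sup>2) \<le> sqrt (2 * pi) * s0 * b0" "sqrt (2 * pi) * s0 * b0 \<le> 1" "s0 \<ge> 7071 / 10000"
proof -
  have s0: "s0\<^sup>2 = real k * real (n - k) / real n"
    unfolding s0_def using k by (intro bin_sd_mode) auto
  have s0_pos: "0 < s0" unfolding s0_def using k by (intro bin_sd_pos) auto
  then have "sqrt (2 * pi) * s0 = sqrt (2 * pi * (real k * real (n - k) / real n))"
    unfolding s0[symmetric] by (simp add: real_sqrt_mult)
  then show "1 - 1 / (4 * s0\<^sup>2) \<le> sqrt (2 * pi) * s0 * b0" "sqrt (2 * pi) * s0 * b0 \<le> 1"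
    unfolding s0 b0_def using Bernstein_mode_stirling[of k n] k by simp_all
  have "real n \<le> 2 * (real k * real (n - k))"
  proof -
    have "n \<le> 2 * (n - k)" using k by simp
    also have "\<dots> \<le> 2 * (k * (n - k))" using k by simp
    finally have "real n \<le> real (2 * (k * (n - k)))" by (rule of_nat_mono)
    then show ?thesis by simp
  qed
  then have "(7071 / 10000)\<^sup>2 \<le> s0\<^sup>2"
    unfolding s0 using k by (simp add: field_simps power2_eq_square)
  then show "s0 \<ge> 7071 / 10000"
    using s0_pos power2_le_imp_le[of "7071 / 10000" s0] by simp
qed

text \<open>
  The inhomogeneous term of the differential equation outside the inflection points of
  \<phi>: there z^2 \<phi>(z) \<le> 0.242 |z|, so it is dominated by the damping term |z|
  \<sigma> = |k - n p|.
\<close>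

lemma gauss_term_bounds:
  fixes z sd \<delta> :: real
  assumes "0 \<le> \<delta>" "\<delta> \<le> 1" "0 \<le> sd" "1 \<le> \<bar>z\<bar>"
  shows "- ((121 / 1000) * (\<bar>z\<bar> * sd)) \<le> sd * std_normal_density z * \<delta> * (1 - z\<^sup>2) / 2"
    and "sd * std_normal_density z * \<delta> * (1 - z\<^sup>2) / 2 \<le> 0"
proof -
  define \<phi> where "\<phi> = std_normal_density z"
  have \<phi>: "0 \<le> \<phi>" by (simp add: \<phi>_def)
  have z2: "1 \<le> z\<^sup>2" using one_le_power[OF assms(4), of 2] by simp
  have "\<phi> * z\<^sup>2 = (\<bar>z\<bar> * \<phi>) * \<bar>z\<bar>"
    by (simp add: power2_eq_square)
  also have "\<dots> \<le> 242 / 1000 * \<bar>z\<bar>"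
    unfolding \<phi>_def by (intro mult_right_mono abs_mult_std_normal_density_le) simp
  finally have a: "\<phi> * z\<^sup>2 \<le> 242 / 1000 * \<bar>z\<bar>" .
  have "\<delta> * (\<phi> * (z\<^sup>2 - 1)) \<le> 1 * (\<phi> * z\<^sup>2)"
    using assms z2 \<phi> by (intro mult_mono mult_left_mono) auto
  with a have "\<delta> * (\<phi> * (z\<^sup>2 - 1)) \<le> 242 / 1000 * \<bar>z\<bar>" by simp
  then have "sd * (\<delta> * (\<phi> * (z\<^sup>2 - 1))) \<le> sd * ((242 / 1000) * \<bar>z\<bar>)"
    using assms by (intro mult_left_mono)
  then show "- ((121 / 1000) * (\<bar>z\<bar> * sd)) \<le> sd * std_normal_density z * \<delta> * (1 - z\<^sup>2) / 2"
    unfolding \<phi>_def[symmetric] by (simp add: algebra_simps)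
  have "0 \<le> sd * \<phi> * \<delta> * (z\<^sup>2 - 1)" using assms \<phi> z2 by (intro mult_nonneg_nonneg) auto
  then show "sd * std_normal_density z * \<delta> * (1 - z\<^sup>2) / 2 \<le> 0"
    unfolding \<phi>_def[symmetric] by (simp add: algebra_simps)
qed

text \<open>
  To the left of the mode and above the level 0.516 the damping term beats the inhomogeneous
  term. From above this holds for every z: where |z| < 1 the inhomogeneous term is itself
  nonnegative. From below the smallness for |z| < 1 has to be supplied.
\<close>

lemma local_err_drift_left:
  assumes n: "0 < n" "k \<le> n" and s: "0 < s" "s \<le> 1 / 2" "s < real k / real n"
  defines "X \<equiv> bin_sd n s * std_normal_density (bin_z n k s) * (1 - 2 * s) * (1 - (bin_z n k s)\<^sup>2) / 2"
  shows "(516 / 1000) < local_err n k s \<Longrightarrow> \<exists>D>0. (local_err n k has_real_derivative D) (at s)"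
    and "local_err n k s < - (516 / 1000) \<Longrightarrow> X \<le> 45 / 100 * (real k - real n * s) \<Longrightarrow> 
            \<exists>D<0. (local_err n k has_real_derivative D) (at s)"
proof -
  define d where "d = real k - real n * s"
  define E where "E = local_err n k s"
  have s1: "s < 1" using s by simp
  have d: "d > 0" using s n by (simp add: d_def field_simps)
  have zd: "bin_z n k s * bin_sd n s = d"
    using bin_z_mult_sd[OF n(1) s(1) s1] by (simp add: d_def)
  have sd: "bin_sd n s > 0" using n s by (intro bin_sd_pos) auto
  have z: "bin_z n k s > 0" using zd d sd zero_less_mult_pos2[of "bin_z n k s" "bin_sd n s"] by simp
  have X: "- ((45 / 100) * d) \<le> X"
  proof (cases "1 \<le> bin_z n k s")
    case True
    then have "- ((121 / 1000) * (\<bar>bin_z n k s\<bar> * bin_sd n s)) \<le> X"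
      unfolding X_def using s sd by (intro gauss_term_bounds) auto
    with z d show ?thesis by (simp add: zd)
  next
    case False
    then have "(bin_z n k s)\<^sup>2 \<le> 1" using z by (simp add: power_le_one)
    then have "0 \<le> X"
      unfolding X_def using s sd by (intro mult_nonneg_nonneg divide_nonneg_pos) auto
    with d show ?thesis by linarith
  qed
  have deriv: "(local_err n k has_real_derivative (E * (d + (1 - 2 * s)) + X) / (s * (1 - s))) (at s)"
    unfolding E_def d_def X_def using DERIV_local_err[OF n(1) s(1) s1 n(2)] .
  have pq: "0 < s * (1 - s)" using s by simp
  show "\<exists>D>0. (local_err n k has_real_derivative D) (at s)" if "(516 / 1000) < local_err n k s"
  proof -
    have "(516 / 1000) < E" using that by (simp add: E_def)
    then have "516 / 1000 * (d + (1 - 2 * s)) \<le> E * (d + (1 - 2 * s))"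
      using d s by (intro mult_right_mono) auto
    moreover have "516 / 1000 * (d + (1 - 2 * s)) \<ge> 516 / 1000 * d" using s by simp
    ultimately have "E * (d + (1 - 2 * s)) + X > 0" using X d by linarith
    with deriv pq show ?thesis
      by (intro exI conjI) (auto intro: divide_pos_pos)
  qed
  show "\<exists>D<0. (local_err n k has_real_derivative D) (at s)"
    if "local_err n k s < - (516 / 1000)" "X \<le> 45 / 100 * (real k - real n * s)"
  proof -
    have "E < - (516 / 1000)" "X \<le> 45 / 100 * d" using that by (simp_all add: E_def d_def)
    from this(1) have "E * (d + (1 - 2 * s)) \<le> - (516 / 1000) * (d + (1 - 2 * s))"
      using d s by (intro mult_right_mono) auto
    moreover have "- (516 / 1000) * (d + (1 - 2 * s)) \<le> - (516 / 1000) * d" using s by simp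
    ultimately have "E * (d + (1 - 2 * s)) + X < 0" using \<open>X \<le> 45 / 100 * d\<close> d by linarith
    with deriv pq show ?thesis
      by (intro exI conjI) (auto intro: divide_neg_pos)
  qed
qed

lemma mode_le_half:
  assumes "0 < k" "2 * k \<le> n"
  shows "0 < real k / real n" "real k / real n \<le> 1 / 2"
proof -
  have "2 * real k \<le> real n" using assms(2) by linarith
  with assms show "0 < real k / real n" "real k / real n \<le> 1 / 2" by (auto simp: field_simps)
qed

lemma local_err_mode_le_0:
  assumes k: "0 < k" "2 * k \<le> n"
  shows "local_err n k (real k / real n) \<le> 0"
proof -
  have n: "0 < n" using k by simp
  have "local_err n k (real k / real n) = std_normal_density 0 * bin_sd n (real k / real n) * 
     (sqrt (2 * pi) * bin_sd n (real k / real n) * Bernstein n k (real k / real n) - 1)"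
    unfolding local_err_eq bin_z_mode[OF n] by (simp add: power2_eq_square algebra_simps)
  also have "\<dots> \<le> 0"
    using mode_bounds(2,3)[OF k] by (intro mult_nonneg_nonpos) auto
  finally show ?thesis .
qed

text \<open>
  The error at the mode is at most 0 by Stirling's formula, and to its left the barrier
  argument keeps it below the level.
\<close>

lemma local_err_upper_left:
  assumes k: "0 < k" "2 * k \<le> n" and p: "0 < p" "p \<le> real k / real n"
  shows "local_err n k p \<le> 516 / 1000"
proof (rule le_of_pos_deriv_above[where b = "real k / real n", OF p(2)])
  note p0 = mode_le_half[OF k]
  show "continuous_on {p..real k / real n} (local_err n k)"
    using k p p0 by (intro continuous_on_local_err) auto
  show "local_err n k (real k / real n) \<le> 516 / 1000" using local_err_mode_le_0[OF k] by simp
  fix s assume s: "p \<le> s" "s < real k / real n" "(516 / 1000) < local_err n k s"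
  then have "0 < s" "s \<le> 1 / 2" using p p0 by linarith+
  with s k show "\<exists>D>0. (local_err n k has_real_derivative D) (at s)"
    by (intro local_err_drift_left(1)) auto
qed

text \<open>
  Left of the mode the ratio of b to \<phi>(z) is at least its value at the mode. This
  bounds the loss by \<phi>(z) times \<sigma> - \<sigma>^2/\<sigma>0, which is at most |z|/2
  because \<sigma>0^2 - \<sigma>^2 \<le> z \<sigma>, plus the error of Stirling's formula.
\<close>

lemma local_err_lower_left:
  assumes k: "0 < k" "2 * k \<le> n" and p: "0 < p" "p \<le> real k / real n"
  shows "- (516 / 1000) \<le> local_err n k p"
proof -
  note p0 = mode_le_half[OF k]
  have n: "0 < n" "k \<le> n" using k by auto
  have p1: "p < 1" "p \<le> 1 / 2" using p p0 by linarith+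
  define s0 where "s0 = bin_sd n (real k / real n)"
  define b0 where "b0 = Bernstein n k (real k / real n)"
  define s where "s = bin_sd n p"
  define z where "z = bin_z n k p"
  define c where "c = sqrt (2 * pi)"
  define Q where "Q = Bernstein n k p * exp (z\<^sup>2 / 2)"
  note mode = mode_bounds[OF k, folded s0_def b0_def c_def]
  have s: "s > 0" unfolding s_def using n p p1 by (intro bin_sd_pos) auto
  have zs: "z * s = real k - real n * p" unfolding z_def s_def by (rule bin_z_mult_sd) (use n p p1 in auto)
  also have "\<dots> \<ge> 0" using p n by (simp add: field_simps)
  finally have z: "z \<ge> 0" using s by (simp add: zero_le_mult_iff)
  have diff: "s0\<^sup>2 - s\<^sup>2 = (z * s) * (1 - p - real k / real n)"
    unfolding s0_def s_def zs[unfolded s_def] 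
    using n p p1 p0 by (subst bin_sd_square_diff) (auto simp: field_simps)
  have "0 \<le> 1 - p - real k / real n" using p1 p0 by linarith
  then have "0 \<le> s0\<^sup>2 - s\<^sup>2"
    unfolding diff using z s by (intro mult_nonneg_nonneg) auto
  then have s_le: "s \<le> s0" using mode(3) power2_le_imp_le[of s s0] by simp
  have "(s0 - s) * (2 * s) \<le> (s0 - s) * (s0 + s)"
    using s_le by (intro mult_left_mono) auto
  also have "\<dots> = s0\<^sup>2 - s\<^sup>2" by (simp add: power2_eq_square algebra_simps)
  also have "\<dots> \<le> (z * s) * 1"
    unfolding diff using z s p p0 by (intro mult_left_mono) auto
  finally have "2 * (s0 - s) * s \<le> z * s" by (simp only: mult_1_right mult_ac)
  then have s0_s: "s0 - s \<le> z / 2" using s by (simp only: mult_le_cancel_right_pos) simp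
  have Q: "b0 \<le> Q"
    using Bernstein_exp_antimono[OF n p(1,2) p0(2)] by (simp add: b0_def Q_def z_def bin_z_mode n)
  have "s - s\<^sup>2 * c * Q \<le> s - s\<^sup>2 * c * b0"
    using Q by (intro diff_left_mono mult_left_mono) (auto simp: c_def)
  also have "\<dots> = s - (s / s0) * s * (c * s0 * b0)"
    using mode(3) by (simp add: power2_eq_square)
  also have "\<dots> \<le> s - (s / s0) * s * (1 - 1 / (4 * s0\<^sup>2))"
    using s mode(1,3) by (intro diff_left_mono mult_left_mono) auto
  also have "\<dots> = (s / s0) * (s0 - s) + (s / s0) * (s / s0) * (1 / (4 * s0))"
  proof -
    have "s - (s / s0) * s = (s / s0) * (s0 - s)"
      using mode(3) by (simp add: right_diff_distrib)
    moreover have "(s / s0) * s * (1 / (4 * s0\<^sup>2)) = (s / s0) * (s / s0) * (1 / (4 * s0))"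
      by (simp add: power2_eq_square)
    ultimately show ?thesis by (simp add: right_diff_distrib)
  qed
  also have "\<dots> \<le> 1 * (z / 2) + 1 * 1 * (1 / (4 * s0))"
  proof (intro add_mono mult_mono)
    show "s / s0 \<le> 1" "s / s0 \<le> 1" using s_le mode(3) by simp_all
  qed (use s s_le s0_s z mode(3) in auto)
  also have "1 / (4 * s0) \<le> 354 / 1000"
    using mode(3) by (simp add: field_simps)
  finally have "s - s\<^sup>2 * c * Q \<le> z / 2 + (354 / 1000)" by simp
  then have "std_normal_density z * (s - s\<^sup>2 * c * Q) \<le> std_normal_density z * (z / 2 + (354 / 1000))"
    by (intro mult_left_mono) auto
  also have "\<dots> \<le> 516 / 1000"
    using abs_mult_std_normal_density_le[of z] z std_normal_density_bounded[of z] by (simp add: algebra_simps)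
  finally show ?thesis
    unfolding local_err_eq by (simp add: s_def z_def c_def Q_def algebra_simps)
qed

text \<open>
  After replacing exp (y^2/2) by its quadratic Taylor polynomial in y^2/2, the claim says
  that a quartic in y is nonnegative; it is a sum of squares plus terms with nonnegative
  coefficients.
\<close>

lemma quartic_density_bound:
  fixes y :: real
  assumes "0 \<le> y"
  shows "std_normal_density y * (y * (1 / 2 + (71 / 100) * y + (25205 / 100000) * y\<^sup>2)) \<le> 516 / 1000"
proof -
  define t where "t = y\<^sup>2 / 2"
  have t: "0 \<le> t" by (simp add: t_def)
  have "1 + t + t\<^sup>2 / 2 \<le> exp t" using exp_lower_Taylor_quadratic[OF t] .
  also have "exp t = exp (y\<^sup>2 / 2)" by (simp add: t_def)
  finally have e: "1 + t + t\<^sup>2 / 2 \<le> exp (y\<^sup>2 / 2)" .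
  \<comment> \<open>12932/10000 is slightly below 0.516/0.399, where 0.399 bounds 1/sqrt (2 \<pi>).\<close>
  have poly: "y * (1 / 2 + 71 / 100 * y + 25205 / 100000 * y\<^sup>2) \<le> 12932 / 10000 * (1 + t + t\<^sup>2 / 2)"
  proof -
    \<comment> \<open>Chosen so that the cubic terms of the quartic and of the first square agree.\<close>
    define a :: real where "a = 25205 / 80000"
    have "(2 / 5 * y\<^sup>2 - a * y - 7 / 10)\<^sup>2 = 4 / 25 * y ^ 4 - 25205 / 100000 * y ^ 3 + (a\<^sup>2 - 14 / 25) * y\<^sup>2 
        + 25205 * 14 / 800000 * y + 49 / 100"
      by (simp add: a_def power2_eq_square power3_eq_cube power4_eq_xxxx algebra_simps)
    moreover have "(y - 6 / 5)\<^sup>2 = y\<^sup>2 - 12 / 5 * y + 36 / 25" "(y - 7 / 20)\<^sup>2 = y\<^sup>2 - 7 / 10 * y + 49 / 400"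
      by (simp_all add: power2_eq_square algebra_simps)
    moreover have "y * (1 / 2 + 71 / 100 * y + 25205 / 100000 * y\<^sup>2) = y / 2 + 71 / 100 * y\<^sup>2 + 25205 / 100000 * y ^ 3"
      by (simp add: power2_eq_square power3_eq_cube algebra_simps)
    moreover have "12932 / 10000 * (1 + t + t\<^sup>2 / 2) = 12932 / 10000 + 6466 / 10000 * y\<^sup>2 + 16165 / 100000 * y ^ 4"
      by (simp add: t_def power2_eq_square power4_eq_xxxx algebra_simps)
    moreover have "a\<^sup>2 * y\<^sup>2 \<le> 993 / 10000 * y\<^sup>2"
      by (intro mult_right_mono) (simp_all add: a_def power2_eq_square)
    moreover have "0 \<le> (2 / 5 * y\<^sup>2 - a * y - 7 / 10)\<^sup>2" "0 \<le> (y - 6 / 5)\<^sup>2" "0 \<le> (y - 7 / 20)\<^sup>2" 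
      "0 \<le> y ^ 4" "0 \<le> y\<^sup>2"
      by simp_all
    ultimately show ?thesis using assms by (simp only: left_diff_distrib)
  qed
  have "y * (1 / 2 + 71 / 100 * y + 25205 / 100000 * y\<^sup>2) \<le> 12932 / 10000 * exp (y\<^sup>2 / 2)"
    by (rule order_trans[OF poly]) (intro mult_left_mono e, simp)
  then have "std_normal_density y * (y * (1 / 2 + 71 / 100 * y + 25205 / 100000 * y\<^sup>2))
      \<le> (399 / 1000 * exp (- (y\<^sup>2 / 2))) * (12932 / 10000 * exp (y\<^sup>2 / 2))"
    by (rule mult_mono[OF std_normal_density_le]) (use assms in auto)
  also have "\<dots> = 399 / 1000 * (12932 / 10000)"
    by (simp add: exp_minus)
  finally show ?thesis by simp
qed

text \<open>
  Between the mode and 1/2 the ratio of b to \<phi>(z) is at most its value at the mode, so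
  with r = \<sigma>/\<sigma>0 the error is at most \<phi>(y) r (r - 1) \<sigma>0. The
  difference of the variances, at most y \<sigma>, bounds r by a quadratic polynomial in y.
\<close>

lemma local_err_upper_right:
  assumes k: "0 < k" "2 * k \<le> n" and p: "real k / real n \<le> p" "p \<le> 1 / 2"
  shows "local_err n k p \<le> 516 / 1000"
proof -
  note p0 = mode_le_half[OF k]
  have n: "0 < n" "k \<le> n" using k by auto
  have p1: "p < 1" "0 < p" using p p0 by linarith+
  define s0 where "s0 = bin_sd n (real k / real n)"
  define b0 where "b0 = Bernstein n k (real k / real n)"
  define s where "s = bin_sd n p"
  define z where "z = bin_z n k p"
  define y where "y = - z"
  define c where "c = sqrt (2 * pi)"
  define Q where "Q = Bernstein n k p * exp (z\<^sup>2 / 2)"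
  define r where "r = s / s0"
  note mode = mode_bounds[OF k, folded s0_def b0_def c_def]
  have s0: "s0 > 0" using mode(3) by linarith
  have s: "s > 0" unfolding s_def using n p1 by (intro bin_sd_pos) auto
  have "z * s = real k - real n * p" unfolding z_def s_def by (rule bin_z_mult_sd) (use n p1 in auto)
  then have ys: "y * s = real n * p - real k" by (simp add: y_def)
  also have "\<dots> \<ge> 0" using p n by (simp add: field_simps)
  finally have y: "y \<ge> 0" using s by (simp add: zero_le_mult_iff)
  have diff: "s\<^sup>2 - s0\<^sup>2 = (y * s) * (1 - p - real k / real n)"
    unfolding s0_def s_def ys[unfolded s_def] 
    using n p p1 p0 by (subst bin_sd_square_diff) (auto simp: field_simps)
  have pp: "0 \<le> 1 - p - real k / real n" "1 - p - real k / real n \<le> 1" using p p1 p0 by linarith+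
  have "0 \<le> s\<^sup>2 - s0\<^sup>2"
    unfolding diff using y s pp by (intro mult_nonneg_nonneg) auto
  then have s_le: "s0 \<le> s" using s s0 power2_le_imp_le[of s0 s] by simp
  then have r: "1 \<le> r" using s0 by (simp add: r_def)
  have s_eq: "s = r * s0" using s0 by (simp add: r_def)
  have sq_le: "s\<^sup>2 - s0\<^sup>2 \<le> (y * s) * 1"
    unfolding diff using y s pp by (intro mult_left_mono) auto
  then have "(r\<^sup>2 - 1) * s0 * s0 \<le> (y * r) * s0"
    unfolding s_eq by (simp add: power2_eq_square algebra_simps)
  then have r1: "(r\<^sup>2 - 1) * s0 \<le> y * r"
    using s0 mult_le_cancel_right_pos by blast
  \<comment> \<open>Solving r^2 - 1 \<le> t r with t = 1.42 y gives r \<le> t/2 + sqrt (1 + t^2/4) \<le> 1 + t/2 + t^2/8.\<close>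
  have rr: "r \<le> 1 + (71 / 100) * y + (25205 / 100000) * y\<^sup>2"
  proof -
    have "(r\<^sup>2 - 1) * (7071 / 10000) \<le> (r\<^sup>2 - 1) * s0" 
      using r mode(3) by (intro mult_left_mono) auto
    with r1 have "7071 / 10000 * (r\<^sup>2 - 1) \<le> y * r" by linarith
    also have "y * r \<le> 7071 / 10000 * ((142 / 100) * (y * r))" using y r by simp
    finally have "r\<^sup>2 - 1 \<le> 142 / 100 * (y * r)"
      by (rule mult_left_le_imp_le) simp
    then have "(r - (71 / 100) * y)\<^sup>2 \<le> 1 + ((71 / 100) * y)\<^sup>2"
      by (simp add: power2_eq_square algebra_simps)
    also have "\<dots> \<le> (1 + (25205 / 100000) * y\<^sup>2)\<^sup>2"
      using y by (simp add: power2_eq_square algebra_simps)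
    finally have "r - (71 / 100) * y \<le> 1 + (25205 / 100000) * y\<^sup>2"
      using power2_le_imp_le[of "r - (71 / 100) * y" "1 + (25205 / 100000) * y\<^sup>2"] by simp
    then show ?thesis by simp
  qed
  have Q: "Q \<le> b0"
    using Bernstein_exp_antimono[OF n p0(1) p] by (simp add: b0_def Q_def z_def bin_z_mode n)
  have "s\<^sup>2 * c * Q - s \<le> s\<^sup>2 * c * b0 - s"
    using Q by (intro diff_right_mono mult_left_mono) (auto simp: c_def)
  also have "\<dots> = r * s * (c * s0 * b0) - s"
    using s0 by (simp add: r_def power2_eq_square)
  also have "\<dots> \<le> r * s * 1 - s"
    using s r mode(2) by (intro diff_right_mono mult_left_mono) auto
  also have "\<dots> = r * ((r - 1) * s0)"
    by (simp add: s_eq algebra_simps)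
  \<comment> \<open>Here r^2/(r + 1) \<le> r - 1/2 is used, which holds for r \<ge> 1.\<close>
  also have "\<dots> \<le> y * (r - 1 / 2)"
  proof -
    have "r * ((r - 1) * s0) * (r + 1) = r * ((r\<^sup>2 - 1) * s0)"
      by (simp add: power2_eq_square algebra_simps)
    also have "\<dots> \<le> r * (y * r)" using r1 r by (intro mult_left_mono) auto
    also have "\<dots> \<le> y * (r - 1 / 2) * (r + 1)"
    proof -
      have "y * (r * r) \<le> y * ((r - 1 / 2) * (r + 1))"
        using r y by (intro mult_left_mono) (auto simp: algebra_simps)
      then show ?thesis by (simp only: mult_ac)
    qed
    finally show ?thesis using r mult_le_cancel_right_pos[of "r + 1"] by simp
  qed
  also have "\<dots> \<le> y * (1 / 2 + (71 / 100) * y + (25205 / 100000) * y\<^sup>2)"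
    using rr y by (intro mult_left_mono) auto
  finally have "std_normal_density y * (s\<^sup>2 * c * Q - s) \<le> 
      std_normal_density y * (y * (1 / 2 + (71 / 100) * y + (25205 / 100000) * y\<^sup>2))"
    by (intro mult_left_mono) auto
  also have "\<dots> \<le> 516 / 1000" using y by (rule quartic_density_bound)
  finally have "std_normal_density z * (s\<^sup>2 * c * Q - s) \<le> 516 / 1000"
    by (simp add: y_def std_normal_density_def)
  then show ?thesis
    unfolding local_err_eq by (simp add: s_def z_def c_def Q_def mult_ac)
qed

text \<open>
  The square of z is n times the product of (p - k/n)/p and (p - k/n)/(1 - p), both of which
  increase to the right of the mode.
\<close>

lemma bin_z_square_mono:
  assumes k: "0 < k" "2 * k \<le> n" and u: "real k / real n \<le> u" "u \<le> s" "s < 1"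
  shows "(bin_z n k u)\<^sup>2 \<le> (bin_z n k s)\<^sup>2"
proof -
  define p0 where "p0 = real k / real n"
  have n: "0 < n" using k by simp
  have p0: "0 < p0" "p0 \<le> 1 / 2" "p0 \<le> u" using mode_le_half[OF k] u by (auto simp: p0_def)
  have z2: "(bin_z n k x)\<^sup>2 = real n * (((x - p0) / x) * ((x - p0) / (1 - x)))" if "0 < x" "x < 1" for x
  proof -
    have k_eq: "real k = real n * p0" using n by (simp add: p0_def)
    have "(bin_z n k x)\<^sup>2 = (real n * p0 - real n * x)\<^sup>2 / (real n * x * (1 - x))"
      using that by (simp add: bin_z_def power_divide bin_sd_square k_eq)
    also have "\<dots> = real n * (((x - p0) / x) * ((x - p0) / (1 - x)))"
      using n that by (simp add: divide_simps) (simp add: power2_eq_square algebra_simps)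
    finally show ?thesis .
  qed
  have "(u - p0) / u \<le> (s - p0) / s"
    using p0 u by (simp add: field_simps)
  moreover have "(u - p0) / (1 - u) \<le> (s - p0) / (1 - s)"
    using p0 u by (intro frac_le) auto
  ultimately have "((u - p0) / u) * ((u - p0) / (1 - u)) \<le> ((s - p0) / s) * ((s - p0) / (1 - s))"
    using p0 u by (intro mult_mono) auto
  then have "real n * (((u - p0) / u) * ((u - p0) / (1 - u))) \<le> real n * (((s - p0) / s) * ((s - p0) / (1 - s)))"
    by (intro mult_left_mono) auto
  moreover have "(bin_z n k u)\<^sup>2 = real n * (((u - p0) / u) * ((u - p0) / (1 - u)))"
    using p0 u by (intro z2) auto
  moreover have "(bin_z n k s)\<^sup>2 = real n * (((s - p0) / s) * ((s - p0) / (1 - s)))"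
    using p0 u by (intro z2) auto
  ultimately show ?thesis by (simp only:)
qed

text \<open>
  Two regimes. While |z| \<le> 1 the ratio of b to its approximation increases from its
  value at the mode, which Stirling's formula bounds from below. Beyond that the barrier
  argument applies; the negative part of the error never exceeds \<sigma> \<phi>(z), and
  this absorbs the antidamping contribution 1 - 2p of the growing variance.
\<close>

lemma local_err_lower_right:
  assumes k: "0 < k" "2 * k \<le> n" and p: "real k / real n \<le> p" "p \<le> 1 / 2"
  shows "- (516 / 1000) \<le> local_err n k p"
proof -
  note p0 = mode_le_half[OF k]
  have n: "0 < n" "k \<le> n" using k by auto
  define s0 where "s0 = bin_sd n (real k / real n)"
  define b0 where "b0 = Bernstein n k (real k / real n)"
  define c where "c = sqrt (2 * pi)"
  note mode = mode_bounds[OF k, folded s0_def b0_def c_def]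
  have near: "- local_err n k u \<le> 516 / 1000" 
    if u: "real k / real n \<le> u" "u \<le> 1 / 2" and z1: "(bin_z n k u)\<^sup>2 \<le> 1" for u
  proof -
    define s where "s = bin_sd n u"
    define z where "z = bin_z n k u"
    define Q where "Q = Bernstein n k u * exp (z\<^sup>2 / 2)"
    have u1: "u < 1" "0 < u" using u p0 by linarith+
    have s: "s > 0" unfolding s_def using n u1 by (intro bin_sd_pos) auto
    have zs: "z * s = real k - real n * u" unfolding z_def s_def by (rule bin_z_mult_sd) (use n u1 in auto)
    then have ys: "- z * s = real n * u - real k" by simp
    also have "\<dots> \<ge> 0" using u n by (simp add: field_simps)
    finally have y: "- z \<ge> 0" using s by (simp add: mult_le_0_iff)
    have z1': "- z \<le> 1" using z1 power2_le_imp_le[of "- z" 1] by (simp add: z_def)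
    have diff: "s\<^sup>2 - s0\<^sup>2 = (- z * s) * (1 - u - real k / real n)"
      unfolding s0_def s_def ys[unfolded s_def] 
      using n u u1 p0 by (subst bin_sd_square_diff) (auto simp: field_simps)
    also have "\<dots> \<le> (- z * s) * 1"
      using y s u u1 p0 by (intro mult_left_mono) (auto simp: mult_le_0_iff)
    also have "\<dots> \<le> 1 * (s + s0)"
      using y s mode(3) z1' unfolding mult_1_right by (intro mult_mono) auto
    finally have "(s - s0) * (s + s0) \<le> 1 * (s + s0)"
      by (simp add: power2_eq_square algebra_simps)
    then have s_le: "s \<le> s0 + 1" using s mode(3) mult_le_cancel_right_pos[of "s + s0"] by simp
    have "s0 * b0 \<le> s * Q"
    proof -
      have "(bin_z n k x)\<^sup>2 \<le> 1" if "real k / real n \<le> x" "x \<le> u" for x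
        using order_trans[OF bin_z_square_mono[OF k that u1(1)] z1] .
      from sd_Bernstein_exp_mono[OF n p0(1) u this] show ?thesis
        by (simp add: s0_def b0_def s_def Q_def z_def bin_z_mode n)
    qed
    then have "c * (s0 * b0) \<le> c * (s * Q)" by (intro mult_left_mono) (auto simp: c_def)
    with mode(1) have "1 - 1 / (4 * s0\<^sup>2) \<le> c * (s * Q)" by simp
    then have "s * (1 - 1 / (4 * s0\<^sup>2)) \<le> s * (c * (s * Q))" using s by (intro mult_left_mono) auto
    then have "s - s\<^sup>2 * c * Q \<le> s * (1 / (4 * s0\<^sup>2))"
      by (simp add: power2_eq_square algebra_simps)
    also have "\<dots> \<le> (s0 + 1) * (1 / (4 * s0\<^sup>2))"
      using s_le by (intro mult_right_mono) auto
    also have "\<dots> \<le> 9 / 10"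
    proof -
      have "7071 / 10000 * s0 \<le> s0 * s0" using mode(3) by (intro mult_right_mono) auto
      then have "s0 + 1 \<le> 9 / 10 * (4 * s0\<^sup>2)" using mode(3) unfolding power2_eq_square by linarith
      then show ?thesis using mode(3) by (simp add: field_simps)
    qed
    finally have "std_normal_density z * (s - s\<^sup>2 * c * Q) \<le> std_normal_density z * (9 / 10)"
      by (intro mult_left_mono) auto
    also have "\<dots> \<le> 399 / 1000 * (9 / 10)"
      by (intro mult_right_mono std_normal_density_bounded) auto
    finally have "std_normal_density z * (s - s\<^sup>2 * c * Q) \<le> 516 / 1000" by simp
    then show ?thesis
      unfolding local_err_eq by (simp add: s_def z_def c_def Q_def algebra_simps)
  qed
  have "- local_err n k p \<le> 516 / 1000"
  proof (rule le_of_neg_deriv_above[where a = "real k / real n", OF p(1)])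
    show "continuous_on {real k / real n..p} (\<lambda>p. - local_err n k p)"
      using n p p0 by (intro continuous_on_minus continuous_on_local_err) auto
    show "- local_err n k (real k / real n) \<le> 516 / 1000"
      using n p0 by (intro near) (auto simp: bin_z_mode)
    fix s assume s: "real k / real n < s" "s \<le> p" "(516 / 1000) < - local_err n k s"
    define e where "e = - local_err n k s"
    define sd where "sd = bin_sd n s"
    define y where "y = - bin_z n k s"
    define \<phi> where "\<phi> = std_normal_density (bin_z n k s)"
    have s1: "0 < s" "s < 1" "s \<le> 1 / 2" using s p p0 by linarith+
    have sd: "sd > 0" unfolding sd_def using n s1 by (intro bin_sd_pos) auto
    have yd: "y * sd = real n * s - real k" 
      using bin_z_mult_sd[OF n(1) s1(1,2), of k] by (simp add: y_def sd_def)
    also have "\<dots> > 0" using s n by (simp add: field_simps)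
    finally have y0: "y > 0" using sd zero_less_mult_pos2[of y sd] by simp
    have "\<not> (bin_z n k s)\<^sup>2 \<le> 1" using near[of s] s s1 by auto
    then have y1: "y > 1" using y0 power_le_one[of y 2] by (force simp: y_def)
    have e_le: "e \<le> sd * \<phi>"
      unfolding e_def sd_def \<phi>_def local_err_def using s1 by (auto intro!: mult_nonneg_nonneg Bernstein_nonneg)
    have yphi: "y * \<phi> \<le> 242 / 1000" using abs_mult_std_normal_density_le[of "bin_z n k s"] y0 
      by (simp add: \<phi>_def y_def)
    have "e * (1 - 2 * s) \<le> sd * \<phi> * (1 - 2 * s)" using e_le s1 by (intro mult_right_mono) auto
    then have "- (e * (y * sd)) + e * (1 - 2 * s) + sd * \<phi> * (1 - 2 * s) * (y\<^sup>2 - 1) / 2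
       \<le> - (e * (y * sd)) + sd * \<phi> * (1 - 2 * s) * ((y\<^sup>2 + 1) / 2)"
      by (simp add: field_simps)
    also have "sd * \<phi> * (1 - 2 * s) * ((y\<^sup>2 + 1) / 2) \<le> sd * \<phi> * 1 * y\<^sup>2"
    proof (intro mult_mono)
      show "(y\<^sup>2 + 1) / 2 \<le> y\<^sup>2" using one_le_power[of y 2] y1 by simp
    qed (use sd s1 in \<open>auto simp: \<phi>_def\<close>)
    also have "\<dots> = (y * \<phi>) * (y * sd)" by (simp add: power2_eq_square)
    also have "\<dots> \<le> 242 / 1000 * (y * sd)" using yphi y0 sd by (intro mult_right_mono) auto
    also have "- (e * (y * sd)) + (242 / 1000) * (y * sd) < 0"
    proof -
      have "242 / 1000 * (y * sd) < e * (y * sd)" using s(3) y0 sd by (intro mult_strict_right_mono) (auto simp: e_def)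
      then show ?thesis by simp
    qed
    finally have neg: "- (e * (y * sd)) + e * (1 - 2 * s) + sd * \<phi> * (1 - 2 * s) * (y\<^sup>2 - 1) / 2 < 0" by simp
    have "((\<lambda>p. - local_err n k p) has_real_derivative - ((local_err n k s * (real k - real n * s + (1 - 2 * s)) 
        + sd * \<phi> * (1 - 2 * s) * (1 - (bin_z n k s)\<^sup>2) / 2) / (s * (1 - s)))) (at s)"
      unfolding sd_def \<phi>_def by (intro DERIV_minus DERIV_local_err n s1)
    moreover have "- ((local_err n k s * (real k - real n * s + (1 - 2 * s)) 
        + sd * \<phi> * (1 - 2 * s) * (1 - (bin_z n k s)\<^sup>2) / 2) / (s * (1 - s)))
      = (- (e * (y * sd)) + e * (1 - 2 * s) + sd * \<phi> * (1 - 2 * s) * (y\<^sup>2 - 1) / 2) / (s * (1 - s))"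
    proof -
      have "- (local_err n k s * (real k - real n * s + (1 - 2 * s)) 
        + sd * \<phi> * (1 - 2 * s) * (1 - (bin_z n k s)\<^sup>2) / 2) 
        = - (e * (y * sd)) + e * (1 - 2 * s) + sd * \<phi> * (1 - 2 * s) * (y\<^sup>2 - 1) / 2"
        unfolding yd by (simp add: e_def y_def algebra_simps diff_divide_distrib add_divide_distrib)
      then show ?thesis by (metis minus_divide_left)
    qed
    ultimately show "\<exists>D<0. ((\<lambda>p. - local_err n k p) has_real_derivative D) (at s)"
      using neg s1 by (intro exI[of _ "(- (e * (y * sd)) + e * (1 - 2 * s) + sd * \<phi> * (1 - 2 * s) * (y\<^sup>2 - 1) / 2) / (s * (1 - s))"])
        (auto intro: divide_neg_pos)
  qed
  then show ?thesis by simp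
qed

section \<open>The local limit theorem in general\<close>

text \<open>
  Exchanging successes and failures.
\<close>

lemma local_err_symmetric:
  assumes "k \<le> n"
  shows "local_err n (n - k) (1 - p) = local_err n k p"
proof -
  have "Bernstein n (n - k) (1 - p) = Bernstein n k p"
    using assms by (simp add: Bernstein_def binomial_symmetric[OF assms, symmetric])
  moreover have "bin_sd n (1 - p) = bin_sd n p"
    by (simp add: bin_sd_def algebra_simps)
  moreover have "bin_z n (n - k) (1 - p) = - bin_z n k p"
  proof -
    have "real (n - k) - real n * (1 - p) = - (real k - real n * p)"
      using assms by (simp add: of_nat_diff algebra_simps)
    then show ?thesis
      unfolding bin_z_def \<open>bin_sd n (1 - p) = bin_sd n p\<close> by (simp only: minus_divide_left)
  qed
  ultimately show ?thesis
    by (simp add: local_err_def std_normal_density_def)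
qed

lemma abs_local_err_mode_le_half:
  assumes k: "0 < k" "2 * k \<le> n" and p: "0 < p" "p \<le> 1 / 2"
  shows "\<bar>local_err n k p\<bar> \<le> 516 / 1000"
  using local_err_upper_left[OF k p(1)] local_err_lower_left[OF k p(1)] 
    local_err_upper_right[OF k _ p(2)] local_err_lower_right[OF k _ p(2)]
  by (cases "p \<le> real k / real n") (auto simp: abs_le_iff)

text \<open>
  If the mode lies to the right of 1/2, Stirling's formula is not needed again: at p = 1/2
  the symmetry reduces the claim to the previous case, and to the left of 1/2 the barrier
  argument works in both directions, because 1 - 2p is at most twice the distance from p to
  the mode.
\<close>

lemma abs_local_err_mode_ge_half:
  assumes k: "n < 2 * k" "k < n" and p: "0 < p" "p \<le> 1 / 2"
  shows "\<bar>local_err n k p\<bar> \<le> 516 / 1000"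
proof -
  have n: "0 < n" "k \<le> n" using k by auto
  have "2 * k > n" using k by simp
  then have "2 * real k > real n" by linarith
  then have mode: "1 / 2 < real k / real n" using n by (simp add: field_simps)
  have "local_err n k (1 / 2) = local_err n (n - k) (1 / 2)"
    using local_err_symmetric[of k n "1 / 2"] n by simp
  moreover have "\<bar>local_err n (n - k) (1 / 2)\<bar> \<le> 516 / 1000"
    using k by (intro abs_local_err_mode_le_half) auto
  ultimately have half: "\<bar>local_err n k (1 / 2)\<bar> \<le> 516 / 1000" by simp
  have cont: "continuous_on {p..1 / 2} (local_err n k)"
    using n p by (intro continuous_on_local_err) auto
  have "local_err n k p \<le> 516 / 1000"
  proof (rule le_of_pos_deriv_above[OF p(2) cont])
    fix s assume s: "p \<le> s" "s < 1 / 2" "516 / 1000 < local_err n k s"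
    then have "0 < s" "s \<le> 1 / 2" "s < real k / real n" using p mode by linarith+
    from local_err_drift_left(1)[OF n this s(3)]
    show "\<exists>D>0. (local_err n k has_real_derivative D) (at s)" .
  qed (use half in auto)
  moreover have "- local_err n k p \<le> 516 / 1000"
  proof (rule le_of_pos_deriv_above[where f = "\<lambda>p. - local_err n k p", OF p(2)])
    show "continuous_on {p..1 / 2} (\<lambda>p. - local_err n k p)"
      by (intro continuous_on_minus cont)
    fix s assume s: "p \<le> s" "s < 1 / 2" "516 / 1000 < - local_err n k s"
    define z where "z = bin_z n k s"
    define sd where "sd = bin_sd n s"
    define d where "d = real k - real n * s"
    have s1: "0 < s" "s < 1" using s p by linarith+
    have zd: "z * sd = d" unfolding z_def sd_def d_def by (rule bin_z_mult_sd) (use n s1 in auto)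
    have sd: "sd > 0" unfolding sd_def using n s1 by (intro bin_sd_pos) auto
    have "s < real k / real n" using s mode by linarith
    then have d: "d > 0" using n by (simp add: d_def field_simps)
    then have z: "z > 0" using zd sd zero_less_mult_pos2[of z sd] by simp
    have "sd * std_normal_density z * (1 - 2 * s) * (1 - z\<^sup>2) / 2 \<le> 45 / 100 * d"
    proof (cases "1 \<le> z")
      case True
      then have "sd * std_normal_density z * (1 - 2 * s) * (1 - z\<^sup>2) / 2 \<le> 0"
        using s s1 sd by (intro gauss_term_bounds(2)) auto
      with d show ?thesis by linarith
    next
      case False
      \<comment> \<open>The crude bound \<sigma> \<le> n/2 cancels the factor 1/n of the distance to the mode.\<close>
      have "sd\<^sup>2 \<le> (real n / 2)\<^sup>2"
      proof -
        have "s * (1 - s) \<le> 1 / 4"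
          using zero_le_power2[of "s - 1 / 2"] by (simp add: power2_eq_square algebra_simps)
        then have "real n * (s * (1 - s)) \<le> real n * (1 / 4)"
          by (intro mult_left_mono) auto
        also have "\<dots> \<le> real n * (real n * (1 / 4))"
          using n by (intro mult_left_mono) auto
        finally show ?thesis
          using bin_sd_square[of s n] s1 by (simp add: sd_def power_divide power2_eq_square[of "real n"] mult.assoc)
      qed
      then have sd_n: "sd \<le> real n / 2" by (rule power2_le_imp_le) simp
      have "2 * (1 / 2 - s) \<le> 2 * (real k / real n - s)"
        using mode by (intro mult_left_mono diff_right_mono less_imp_le) auto
      then have "1 - 2 * s \<le> 2 * (real k / real n - s)" by (simp only: right_diff_distrib)
      also have "\<dots> = 2 * d / real n" using n by (simp add: d_def field_simps)
      finally have \<delta>: "1 - 2 * s \<le> 2 * d / real n" .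
      have "sd * std_normal_density z * (1 - 2 * s) * (1 - z\<^sup>2) 
        \<le> (real n / 2) * (399 / 1000) * (2 * d / real n) * 1"
      proof (intro mult_mono)
        show "0 \<le> real n / 2 * (399 / 1000) * (2 * d / real n)" using d by simp
        have "0 \<le> 1 - z\<^sup>2" using False z by (simp add: power_le_one)
        then show "0 \<le> 1 - z\<^sup>2" .
      qed (use sd_n std_normal_density_bounded \<delta> s sd in auto)
      also have "\<dots> = 399 / 1000 * d" using n by simp
      finally show ?thesis using d by linarith
    qed
    then show "\<exists>D>0. ((\<lambda>p. - local_err n k p) has_real_derivative D) (at s)"
    proof -
      have "local_err n k s < - (516 / 1000)" "s \<le> 1 / 2" using s by linarith+
      with local_err_drift_left(2)[OF n s1(1) _ \<open>s < real k / real n\<close>]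
        \<open>sd * std_normal_density z * (1 - 2 * s) * (1 - z\<^sup>2) / 2 \<le> 45 / 100 * d\<close>
      obtain D where "D < 0" "(local_err n k has_real_derivative D) (at s)"
        unfolding z_def sd_def d_def by blast
      then show ?thesis
        by (intro exI[of _ "- D"] conjI DERIV_minus) auto
    qed
  qed (use half in auto)
  ultimately show ?thesis by (simp add: abs_le_iff)
qed

lemma mult_one_minus_power_le:
  assumes "0 \<le> (x::real)" "x \<le> 1"
  shows "real n * x * (1 - x) ^ n \<le> 1 / 2"
proof -
  have "(1 - x) ^ n \<le> exp (- x) ^ n"
    using exp_ge_add_one_self[of "- x"] assms by (intro power_mono) auto
  then have "real n * x * (1 - x) ^ n \<le> real n * x * exp (- x) ^ n"
    using assms by (intro mult_left_mono) auto
  also have "exp (- x) ^ n = exp (- (real n * x))"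
    by (simp flip: exp_of_nat_mult)
  also have "real n * x * exp (- (real n * x)) \<le> exp (real n * x - 1) * exp (- (real n * x))"
    using exp_ge_add_one_self[of "real n * x - 1"] by (intro mult_right_mono) auto
  also have "\<dots> = exp (- 1)" by (simp flip: exp_add)
  also have "\<dots> \<le> 1 / 2" using exp_ge_add_one_self[of 1] by (simp add: exp_minus field_simps)
  finally show ?thesis .
qed

text \<open>
  For k = 0 there is no mode inside the interval, but both terms of the error are small on
  their own, since \<sigma> \<le> |z|.
\<close>

lemma abs_local_err_0:
  assumes n: "0 < n" and p: "0 < p" "p < 1"
  shows "\<bar>local_err n 0 p\<bar> \<le> 516 / 1000"
proof -
  define z where "z = bin_z n 0 p"
  define s where "s = bin_sd n p"
  have s: "s > 0" unfolding s_def using n p by (rule bin_sd_pos)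
  have zs: "z * s = - (real n * p)" using bin_z_mult_sd[OF n p, of 0] by (simp add: z_def s_def)
  have "s\<^sup>2 * Bernstein n 0 p = (1 - p) * (real n * p * (1 - p) ^ n)"
    using p by (simp add: s_def bin_sd_square Bernstein_def)
  also have "\<dots> \<le> 1 * (1 / 2)"
    using p mult_one_minus_power_le[of p n] by (intro mult_mono) auto
  finally have up: "s\<^sup>2 * Bernstein n 0 p \<le> 1 / 2" by simp
  have "s * s \<le> real n * p * 1"
    using p bin_sd_square[of p n] by (simp add: s_def power2_eq_square mult_left_le)
  also have "\<dots> = - z * s" using zs by simp
  finally have sz: "s \<le> - z" using s mult_le_cancel_right_pos[of s s "- z"] by simp
  have "s * std_normal_density z \<le> \<bar>z\<bar> * std_normal_density z"
    using sz by (intro mult_right_mono) auto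
  also have "\<dots> \<le> 242 / 1000" by (rule abs_mult_std_normal_density_le)
  finally have "s * std_normal_density z \<le> 242 / 1000" .
  moreover have "0 \<le> s * std_normal_density z" using s by simp
  moreover have "0 \<le> s\<^sup>2 * Bernstein n 0 p" using p by (simp add: Bernstein_nonneg)
  ultimately show ?thesis
    using up unfolding local_err_def s_def[symmetric] z_def[symmetric] abs_le_iff by linarith
qed

text \<open>
  The local limit theorem |b - \<phi>(z)/\<sigma>| \<le> 0.516/\<sigma>^2 with a constant
  that does not depend on n, k and p. Its use in the derivative of F - G is the source of
  c1.
\<close>

lemma local_limit:
  assumes n: "0 < n" "k \<le> n" and p: "0 < p" "p \<le> 1 / 2"
  shows "\<bar>local_err n k p\<bar> \<le> 516 / 1000"
proof -
  consider "k = 0" | "k = n" | "0 < k" "2 * k \<le> n" | "n < 2 * k" "k < n" using n by linarith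
  then show ?thesis
  proof cases
    case 1
    then show ?thesis using abs_local_err_0 n p by simp
  next
    case 2
    then show ?thesis using abs_local_err_0[of n "1 - p"] local_err_symmetric[of n n p] n p by simp
  next
    case 3
    then show ?thesis using p by (rule abs_local_err_mode_le_half)
  next
    case 4
    then show ?thesis using p by (rule abs_local_err_mode_ge_half)
  qed
qed

section \<open>A uniform bound for the discrepancy\<close>

lemma Phi_le_linear:
  assumes "0 \<le> x"
  shows "Phi x \<le> 1 / 2 + (399 / 1000) * x"
proof -
  have "Phi 0 = 1 / 2" using Phi_minus[of 0] by simp
  moreover have "Phi x - (399 / 1000) * x \<le> Phi 0 - (399 / 1000) * 0"
  proof (rule DERIV_nonpos_imp_nonincreasing[OF assms])
    fix y :: real
    have "((\<lambda>y. Phi y - (399 / 1000) * y) has_real_derivative std_normal_density y - 399 / 1000) (at y)"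
      by (auto intro!: derivative_eq_intros DERIV_Phi)
    then show "\<exists>d. ((\<lambda>y. Phi y - (399 / 1000) * y) has_real_derivative d) (at y) \<and> d \<le> 0"
      using std_normal_density_bounded[of y] by auto
  qed
  ultimately show ?thesis by simp
qed

lemma Phi_nonneg: "0 \<le> Phi x"
proof -
  interpret real_distribution std_normal_distribution by (rule real_dist_normal_dist)
  show ?thesis by (simp add: Phi_def cdf_nonneg)
qed

lemma Phi_mono: "x \<le> y \<Longrightarrow> Phi x \<le> Phi y"
  by (rule DERIV_nonneg_imp_nondecreasing[where f = Phi]) (blast intro: DERIV_Phi normal_density_nonneg)+

text \<open>
  The maximum of the left-hand side is 0.5409... near x = 0.21. For x \<le> 1 the concave
  function \<Phi> is bounded by (nearly) its tangent at 0, and for x \<ge> 1 the first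
  summand alone is at most 1/2.
\<close>

lemma cantelli_minus_Phi_le:
  assumes x: "0 \<le> x"
  shows "1 / (1 + x\<^sup>2) - Phi (- x) \<le> 542 / 1000"
proof (cases "x \<le> 1")
  case True
  define c :: real where "c = 399 / 1000"
  have "1 \<le> (1042 / 1000 - c * x) * (1 + x\<^sup>2)"
  proof -
    \<comment> \<open>The cubic nearly touches zero at 0.22, hence squares centred there.\<close>
    have "0 \<le> (1 - x) * (x - 22 / 100)\<^sup>2" using True by simp
    moreover have "(1 - x) * (x - 22 / 100)\<^sup>2 = x\<^sup>2 - 44 / 100 * x + 484 / 10000 - x ^ 3 + 44 / 100 * x\<^sup>2 - 484 / 10000 * x"
      by (simp add: power2_eq_square power3_eq_cube field_simps)
    moreover have "0 \<le> (x - 22 / 100)\<^sup>2" by simp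
    moreover have "(x - 22 / 100)\<^sup>2 = x\<^sup>2 - 44 / 100 * x + 484 / 10000"
      by (simp add: power2_eq_square algebra_simps)
    moreover have "(1042 / 1000 - c * x) * (1 + x\<^sup>2) = 1042 / 1000 + 1042 / 1000 * x\<^sup>2 - 399 / 1000 * x - 399 / 1000 * x ^ 3"
      by (simp add: c_def power2_eq_square power3_eq_cube field_simps)
    ultimately show ?thesis using x True by linarith
  qed
  then have "1 / (1 + x\<^sup>2) \<le> 1042 / 1000 - c * x"
    by (simp add: pos_divide_le_eq add_pos_nonneg)
  moreover have "1 / 2 - c * x \<le> Phi (- x)"
    using Phi_le_linear[OF x] unfolding Phi_minus c_def by linarith
  ultimately show ?thesis by linarith
next
  case False
  then have "1 \<le> x\<^sup>2" by (intro one_le_power) auto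
  then have "1 / (1 + x\<^sup>2) \<le> 1 / 2" by (intro divide_left_mono) auto
  then show ?thesis using Phi_nonneg[of "- x"] by linarith
qed

lemma binomial_variance:
  "(\<Sum>j\<le>n. (real j - real n * p)\<^sup>2 * Bernstein n j p) = real n * p * (1 - p)"
proof -
  have "(real j - real n * p)\<^sup>2 * Bernstein n j p = real j * (real j - 1) * Bernstein n j p 
      + (1 - 2 * (real n * p)) * (real j * Bernstein n j p) + (real n * p)\<^sup>2 * Bernstein n j p" for j
    by (simp add: power2_eq_square algebra_simps)
  then have "(\<Sum>j\<le>n. (real j - real n * p)\<^sup>2 * Bernstein n j p) = 
     (\<Sum>j\<le>n. real j * (real j - 1) * Bernstein n j p)
      + (1 - 2 * (real n * p)) * (\<Sum>j\<le>n. real j * Bernstein n j p) + (real n * p)\<^sup>2 * (\<Sum>j\<le>n. Bernstein n j p)"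
    by (simp only: sum.distrib sum_distrib_left)
  also have "\<dots> = real n * (real n - 1) * p\<^sup>2 + (1 - 2 * (real n * p)) * (real n * p) + (real n * p)\<^sup>2"
    by (simp only: sum_kk_Bernstein sum_k_Bernstein sum_Bernstein mult_1_right)
  also have "\<dots> = real n * p * (1 - p)"
    by (simp add: power2_eq_square algebra_simps)
  finally show ?thesis .
qed

text \<open>
  Cantelli's inequality for both tails at once: on the tail the quadratic (1 + w x)^2 is at
  least (1 + x^2)^2, where w is the standardized number of successes, and its expectation is
  1 + x^2.
\<close>

lemma binomial_cantelli:
  assumes n: "0 < n" and p: "0 < p" "p < 1" and A: "A \<subseteq> {..n}"
    and t: "\<And>j. j \<in> A \<Longrightarrow> x\<^sup>2 \<le> (real j - real n * p) / bin_sd n p * x"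
  shows "(\<Sum>j\<in>A. Bernstein n j p) \<le> 1 / (1 + x\<^sup>2)"
proof -
  define s where "s = bin_sd n p"
  define w where "w j = (real j - real n * p) / s" for j
  have s: "0 < s" unfolding s_def using n p by (rule bin_sd_pos)
  have s2: "s\<^sup>2 = real n * p * (1 - p)" using p by (simp add: s_def bin_sd_square)
  have pos: "0 < 1 + x\<^sup>2" by (simp add: add_pos_nonneg)
  have B: "0 \<le> Bernstein n j p" for j using p by (simp add: Bernstein_nonneg)
  have m1: "(\<Sum>j\<le>n. w j * Bernstein n j p) = 0"
  proof -
    have "(\<Sum>j\<le>n. w j * Bernstein n j p) = ((\<Sum>j\<le>n. real j * Bernstein n j p) - real n * p * (\<Sum>j\<le>n. Bernstein n j p)) / s"
      by (simp only: w_def sum_divide_distrib[symmetric] sum_subtractf[symmetric] sum_distrib_left times_divide_eq_left left_diff_distrib)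
    then show ?thesis by simp
  qed
  have m2: "(\<Sum>j\<le>n. (w j)\<^sup>2 * Bernstein n j p) = 1"
  proof -
    have "(\<Sum>j\<le>n. (w j)\<^sup>2 * Bernstein n j p) = (\<Sum>j\<le>n. (real j - real n * p)\<^sup>2 * Bernstein n j p) / s\<^sup>2"
      by (simp only: w_def power_divide sum_divide_distrib times_divide_eq_left)
    then show ?thesis using s unfolding binomial_variance s2[symmetric] by simp
  qed
  have "(\<Sum>j\<in>A. Bernstein n j p) * (1 + x\<^sup>2)\<^sup>2 = (\<Sum>j\<in>A. (1 + x\<^sup>2)\<^sup>2 * Bernstein n j p)"
    by (simp add: sum_distrib_right mult.commute)
  also have "\<dots> \<le> (\<Sum>j\<in>A. (1 + w j * x)\<^sup>2 * Bernstein n j p)"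
  proof (intro sum_mono mult_right_mono B power_mono)
    fix j assume "j \<in> A"
    then show "1 + x\<^sup>2 \<le> 1 + w j * x" using t[of j] by (simp add: w_def s_def)
  qed simp
  also have "\<dots> \<le> (\<Sum>j\<le>n. (1 + w j * x)\<^sup>2 * Bernstein n j p)"
    using A B by (intro sum_mono2) auto
  also have "\<dots> = (\<Sum>j\<le>n. Bernstein n j p + 2 * x * (w j * Bernstein n j p) + x\<^sup>2 * ((w j)\<^sup>2 * Bernstein n j p))"
    by (intro sum.cong refl) (simp add: power2_eq_square algebra_simps)
  also have "\<dots> = 1 + x\<^sup>2"
    by (simp add: sum.distrib m1 m2 flip: sum_distrib_left)
  finally have "((\<Sum>j\<in>A. Bernstein n j p) * (1 + x\<^sup>2)) * (1 + x\<^sup>2) \<le> 1 * (1 + x\<^sup>2)"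
    by (simp only: power2_eq_square[of "1 + x\<^sup>2"] mult.assoc mult_1_left)
  then have "(\<Sum>j\<in>A. Bernstein n j p) * (1 + x\<^sup>2) \<le> 1"
    using pos by (rule mult_right_le_imp_le)
  then show ?thesis
    using pos by (simp add: pos_le_divide_eq)
qed

text \<open>
  In one direction the discrepancy is trivially at most 1/2, the normal probability of the
  tail; in the other it is Cantelli's bound minus that normal probability. Half of 0.542 is
  the constant 0.271 in L.
\<close>

lemma F_minus_Phi_bound:
  assumes n: "0 < n" "k \<le> n" and p: "0 < p" "p < 1" and m: "m = k \<or> m = Suc k"
  shows "\<bar>(\<Sum>j<m. Bernstein n j p) - Phi (bin_z n k p)\<bar> \<le> 542 / 1000"
proof -
  define z where "z = bin_z n k p"
  define s where "s = bin_sd n p"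
  have s: "0 < s" unfolding s_def using n p by (intro bin_sd_pos) 
  have B: "0 \<le> Bernstein n j p" for j using p by (simp add: Bernstein_nonneg)
  have split: "(\<Sum>j<m. Bernstein n j p) + (\<Sum>j\<in>{m..n}. Bernstein n j p) = 1"
  proof -
    have "{..n} = {..<m} \<union> {m..n}" using m n by auto
    then have "(\<Sum>j\<le>n. Bernstein n j p) = (\<Sum>j<m. Bernstein n j p) + (\<Sum>j\<in>{m..n}. Bernstein n j p)"
      by (simp only:) (rule sum.union_disjoint, auto)
    then show ?thesis by simp
  qed
  have F0: "0 \<le> (\<Sum>j<m. Bernstein n j p)" "0 \<le> (\<Sum>j\<in>{m..n}. Bernstein n j p)"
    using B by (auto intro: sum_nonneg)
  have tail: "z\<^sup>2 \<le> (real j - real n * p) / bin_sd n p * z"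
    if "(0 \<le> z \<and> k \<le> j) \<or> (z \<le> 0 \<and> j \<le> k)" for j
  proof -
    have "z * z \<le> (real j - real n * p) / s * z"
      using that
    proof
      assume "0 \<le> z \<and> k \<le> j"
      then show ?thesis using s by (intro mult_right_mono) (auto simp: z_def bin_z_def s_def intro!: divide_right_mono)
    next
      assume "z \<le> 0 \<and> j \<le> k"
      then show ?thesis using s by (intro mult_right_mono_neg) (auto simp: z_def bin_z_def s_def intro!: divide_right_mono)
    qed
    then show ?thesis by (simp add: power2_eq_square s_def)
  qed
  have half: "Phi 0 = 1 / 2" using Phi_minus[of 0] by simp
  show ?thesis
  proof (cases "0 \<le> z")
    case True
    have "(\<Sum>j\<in>{m..n}. Bernstein n j p) \<le> 1 / (1 + z\<^sup>2)"
      using True m by (intro binomial_cantelli[OF n(1) p] tail) auto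
    moreover have "1 / (1 + z\<^sup>2) - (1 - Phi z) \<le> 542 / 1000"
      using cantelli_minus_Phi_le[OF True] by (simp add: Phi_minus)
    moreover have "1 / 2 \<le> Phi z" using Phi_mono[OF True] half by simp
    ultimately show ?thesis
      using split F0 unfolding z_def[symmetric] abs_le_iff by linarith
  next
    case False
    have "(\<Sum>j<m. Bernstein n j p) \<le> 1 / (1 + z\<^sup>2)"
      using False m n by (intro binomial_cantelli[OF n(1) p] tail) auto
    moreover have "1 / (1 + z\<^sup>2) - Phi z \<le> 542 / 1000"
      using cantelli_minus_Phi_le[of "- z"] False by simp
    moreover have "Phi z \<le> 1 / 2" using Phi_mono[of z 0] False half by simp
    ultimately show ?thesis
      using F0 unfolding z_def[symmetric] abs_le_iff by linarith
  qed
qed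

section \<open>The normalized discrepancy as a function of p\<close>

lemma sqrt_pq_eq: "sqrt (p * (1 - p)) = bin_sd 1 p"
  by (simp add: bin_sd_def)

lemma inverse_rho_eq: "1 / rho p = bin_sd 1 p / (1 - 2 * p * (1 - p))"
proof -
  have "p\<^sup>2 + (1 - p)\<^sup>2 = 1 - 2 * p * (1 - p)"
    by (simp add: power2_eq_square algebra_simps)
  then show ?thesis by (simp only: rho_def sqrt_pq_eq divide_divide_eq_right mult_1_left)
qed

lemma pq_bounds:
  fixes p :: real
  assumes "0 < p" "p < 1"
  shows "0 < p * (1 - p)" "p * (1 - p) \<le> 1 / 4" "0 < 1 - 2 * p * (1 - p)"
proof -
  show "p * (1 - p) \<le> 1 / 4" using zero_le_power2[of "p - 1 / 2"] by (simp add: power2_eq_square algebra_simps)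
  then show "0 < 1 - 2 * p * (1 - p)" by simp
qed (use assms in simp)

text \<open>
  The logarithmic derivative of 1/\<rho>, which accounts for the last term of L.
\<close>

lemma DERIV_inverse_rho:
  assumes p: "0 < p" "p < 1"
  shows "((\<lambda>p. 1 / rho p) has_real_derivative 
    (1 / rho p) * ((1 - 2 * p) * (1 + 2 * p * (1 - p)) / (2 * (p * (1 - p)) * (1 - 2 * p * (1 - p))))) (at p)"
proof -
  note pq = pq_bounds[OF p]
  define u where "u = p * (1 - p)"
  define w where "w = 1 - 2 * u"
  define s where "s = bin_sd 1 p"
  have u: "0 < u" "0 < w" using pq by (auto simp: u_def w_def)
  have "((\<lambda>p. bin_sd 1 p / (1 - 2 * p * (1 - p))) has_real_derivative
     (s * ((1 - 2 * p) / 2) / u * w - s * (- 2 * (1 - 2 * p))) / (w * w)) (at p)"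
  proof -
    have "((\<lambda>p. 1 - 2 * p * (1 - p)) has_real_derivative (- 2 * (1 - 2 * p))) (at p)"
      by (auto intro!: derivative_eq_intros simp: algebra_simps)
    from DERIV_divide[OF DERIV_bin_sd[OF _ p] this, of 1] pq show ?thesis
      by (simp add: s_def u_def w_def mult.assoc)
  qed
  moreover have "(s * ((1 - 2 * p) / 2) / u * w - s * (- 2 * (1 - 2 * p))) / (w * w) 
     = (s / w) * ((1 - 2 * p) * (1 + 2 * u) / (2 * u * w))"
  proof -
    have "s * ((1 - 2 * p) / 2) / u * w - s * (- 2 * (1 - 2 * p)) = s * (1 - 2 * p) * (w + 4 * u) / (2 * u)"
      using u by (simp add: field_simps)
    also have "w + 4 * u = 1 + 2 * u" by (simp add: w_def)
    finally have e: "s * ((1 - 2 * p) / 2) / u * w - s * (- 2 * (1 - 2 * p)) = s * (1 - 2 * p) * (1 + 2 * u) / (2 * u)" .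
    show ?thesis unfolding e by (simp add: mult_ac)
  qed
  ultimately show ?thesis
    unfolding inverse_rho_eq by (simp add: s_def w_def u_def mult.assoc)
qed

text \<open>
  L is exactly the sum of the two contributions of the product rule to the derivative of (F
  - G)/\<rho>.
\<close>

lemma L_eq:
  assumes p: "0 < p" "p < 1"
  shows "L p = (1 / rho p) / (p * (1 - p)) * (516 / 1000 / p + 121 / 1000) 
     + (1 / rho p) * ((1 - 2 * p) * (1 + 2 * p * (1 - p)) / (2 * (p * (1 - p)) * (1 - 2 * p * (1 - p)))) * (542 / 1000)"
proof -
  note pq = pq_bounds[OF p]
  define u where "u = p * (1 - p)"
  define w where "w = 1 - 2 * u"
  define s where "s = bin_sd 1 p"
  have u: "0 < u" "0 < w" using pq by (auto simp: u_def w_def)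
  have s: "0 < s" unfolding s_def using p by (intro bin_sd_pos) auto
  have ss: "s * s = u" using p bin_sd_square[of p 1] by (simp add: s_def u_def power2_eq_square)
  have 1: "s / w / u = 1 / (w * s)"
    unfolding ss[symmetric] using s by simp
  have "L p = 1 / (w * s) * (516 / 1000 / p + 121 / 1000 + 271 / 1000 * ((1 - 2 * p) * (1 + 2 * u) / w))"
    by (simp add: L_def Let_def sqrt_pq_eq s_def w_def u_def mult.assoc)
  also have "\<dots> = s / w / u * (516 / 1000 / p + 121 / 1000) 
      + s / w * ((1 - 2 * p) * (1 + 2 * u) / (2 * u * w)) * (542 / 1000)"
  proof -
    have e: "s / w / u * (271 / 1000 * (x / w)) = s / w * (x / (2 * u * w)) * (542 / 1000)" for x
      by simp
    show ?thesis unfolding 1[symmetric] distrib_left e ..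
  qed
  finally show ?thesis
    unfolding inverse_rho_eq by (simp add: s_def w_def u_def mult.assoc)
qed

lemma abs_deriv_le_L:
  assumes p: "0 < p" "p < 1 " "p \<le> 1 / 2"
    and f: "(f has_real_derivative D) (at p)" "\<bar>f p\<bar> \<le> 542 / 1000" 
    and D: "\<bar>p * (1 - p) * D\<bar> \<le> 516 / 1000 / p + 121 / 1000"
  shows "\<exists>D'. ((\<lambda>p. 1 / rho p * f p) has_real_derivative D') (at p) \<and> \<bar>D'\<bar> \<le> L p"
proof -
  note pq = pq_bounds[OF p(1,2)]
  define r where "r = 1 / rho p"
  define d where "d = (1 - 2 * p) * (1 + 2 * p * (1 - p)) / (2 * (p * (1 - p)) * (1 - 2 * p * (1 - p)))"
  have r: "0 \<le> r" unfolding r_def inverse_rho_eq using pq bin_sd_pos[of 1 p] p by (simp add: less_imp_le)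
  have d: "0 \<le> d" unfolding d_def using pq p by (intro divide_nonneg_pos mult_nonneg_nonneg) auto
  have "((\<lambda>p. 1 / rho p * f p) has_real_derivative (r * d) * f p + D * r) (at p)"
    using DERIV_mult[OF DERIV_inverse_rho[OF p(1,2)] f(1)] by (simp only: r_def d_def)
  moreover have "\<bar>(r * d) * f p + D * r\<bar> \<le> L p"
  proof -
    have "\<bar>D\<bar> = \<bar>p * (1 - p) * D\<bar> / (p * (1 - p))"
      using pq(1) p by (simp add: abs_mult)
    also have "\<dots> \<le> (516 / 1000 / p + 121 / 1000) / (p * (1 - p))"
      using D pq(1) by (intro divide_right_mono) auto
    finally have "\<bar>D\<bar> * r \<le> (516 / 1000 / p + 121 / 1000) / (p * (1 - p)) * r"
      using r by (intro mult_right_mono)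
    moreover have "(r * d) * \<bar>f p\<bar> \<le> (r * d) * (542 / 1000)"
      using r d f(2) by (intro mult_left_mono) auto
    moreover have "\<bar>(r * d) * f p + D * r\<bar> \<le> (r * d) * \<bar>f p\<bar> + \<bar>D\<bar> * r"
      using abs_triangle_ineq[of "(r * d) * f p" "D * r"] r d by (simp add: abs_mult)
    moreover have "L p = r * d * (542 / 1000) + (516 / 1000 / p + 121 / 1000) / (p * (1 - p)) * r"
      unfolding L_eq[OF p(1,2)] r_def[symmetric] d_def[symmetric] by simp
    ultimately show ?thesis by linarith
  qed
  ultimately show ?thesis by blast
qed

text \<open>
  Both F and \<Phi>(z) have derivatives of order sqrt n. Multiplied by p (1 - p), the
  difference of the derivatives is exactly -(E k/(n p) + z \<phi>(z)/2) for F at k and -(E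
  (n - k)/(n (1 - p)) - z \<phi>(z)/2) for F at k + 1, where E is the local error. Both
  weights of E are at most 1/p.
\<close>

lemma deriv_F_minus_G_bounds:
  assumes n: "0 < n" "k \<le> n" and p: "0 < p" "p \<le> 1 / 2"
  defines "D1 \<equiv> - (real k / p) * Bernstein n k p
      - std_normal_density (bin_z n k p) * (- (bin_sd n p + bin_z n k p * (1 - 2 * p) / 2) / (p * (1 - p)))"
  defines "D2 \<equiv> - (real (n - k) / (1 - p)) * Bernstein n k p
      - std_normal_density (bin_z n k p) * (- (bin_sd n p + bin_z n k p * (1 - 2 * p) / 2) / (p * (1 - p)))"
  shows "((\<lambda>p. (\<Sum>j<k. Bernstein n j p) - Phi (bin_z n k p)) has_real_derivative D1) (at p)"
    and "\<bar>p * (1 - p) * D1\<bar> \<le> 516 / 1000 / p + 121 / 1000"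
    and "((\<lambda>p. (\<Sum>j<Suc k. Bernstein n j p) - Phi (bin_z n k p)) has_real_derivative D2) (at p)"
    and "\<bar>p * (1 - p) * D2\<bar> \<le> 516 / 1000 / p + 121 / 1000"
proof -
  have p1: "p < 1" using p by simp
  define z where "z = bin_z n k p"
  define s where "s = bin_sd n p"
  define \<phi> where "\<phi> = std_normal_density z"
  define b where "b = Bernstein n k p"
  define e where "e = local_err n k p"
  show "((\<lambda>p. (\<Sum>j<k. Bernstein n j p) - Phi (bin_z n k p)) has_real_derivative D1) (at p)"
    unfolding D1_def using n p p1
    by (intro DERIV_diff DERIV_sum_Bernstein DERIV_chain2[OF DERIV_Phi DERIV_bin_z]) auto
  show "((\<lambda>p. (\<Sum>j<Suc k. Bernstein n j p) - Phi (bin_z n k p)) has_real_derivative D2) (at p)"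
    unfolding D2_def using n p p1
    by (intro DERIV_diff DERIV_sum_Bernstein_Suc DERIV_chain2[OF DERIV_Phi DERIV_bin_z]) auto
  have e: "\<bar>e\<bar> \<le> 516 / 1000" unfolding e_def by (rule local_limit[OF n p])
  have e_eq: "e = s * s * b - s * \<phi>"
    by (simp add: e_def local_err_def s_def b_def \<phi>_def z_def power2_eq_square)
  have ss: "s * s = real n * p * (1 - p)"
    using bin_sd_square[of p n] p p1 by (simp add: s_def power2_eq_square)
  have zs: "z * s = real k - real n * p"
    unfolding z_def s_def by (rule bin_z_mult_sd) (use n p p1 in auto)
  have s: "0 < s" unfolding s_def using n p p1 by (intro bin_sd_pos) auto
  have zphi: "\<bar>z * \<phi> / 2\<bar> \<le> 121 / 1000"
    using abs_mult_std_normal_density_le[of z] by (simp add: \<phi>_def abs_mult)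
  have np: "0 < real n * p" "0 < real n * (1 - p)" using n p p1 by auto
  \<comment> \<open>With k = n p + z \<sigma>, this turns the weight of the Gaussian term of E into \<sigma> + z (1 - p).\<close>
  have sk: "s * (real k / (real n * p)) = s + z * (1 - p)"
  proof -
    have k_eq: "real k = real n * p + z * s" using zs by simp
    have "s * real k = s * (real n * p) + z * (s * s)" unfolding k_eq by (simp add: algebra_simps)
    also have "\<dots> = (s + z * (1 - p)) * (real n * p)" by (simp add: ss algebra_simps)
    finally have e: "s * real k = (s + z * (1 - p)) * (real n * p)" .
    show ?thesis unfolding times_divide_eq_right e using n p by simp
  qed
  have sk': "s * (real (n - k) / (real n * (1 - p))) = s - z * p"
  proof -
    have k_eq: "real (n - k) = real n * (1 - p) - z * s" using zs n by (simp add: of_nat_diff algebra_simps)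
    have "s * real (n - k) = s * (real n * (1 - p)) - z * (s * s)" unfolding k_eq by (simp add: algebra_simps)
    also have "\<dots> = (s - z * p) * (real n * (1 - p))" by (simp add: ss algebra_simps)
    finally have e: "s * real (n - k) = (s - z * p) * (real n * (1 - p))" .
    show ?thesis unfolding times_divide_eq_right e using n p1 by simp
  qed
  have e_mult: "e * c = s * s * b * c - \<phi> * (s * c)" for c
    unfolding e_eq by (simp add: algebra_simps)
  have tri: "\<bar>- (e * c + y)\<bar> \<le> \<bar>e\<bar> * c + \<bar>y\<bar>" if "0 \<le> c" for c y
    unfolding abs_minus_cancel using abs_triangle_ineq[of "e * c" y] that by (simp add: abs_mult)
  have clear: "P * Q * (- (x / P) * b - \<phi> * (- S / (P * Q))) = - (x * Q * b) + \<phi> * S"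
    "P * Q * (- (x / Q) * b - \<phi> * (- S / (P * Q))) = - (x * P * b) + \<phi> * S"
    if "P \<noteq> 0" "Q \<noteq> 0" for P Q x S
    using that by (simp_all add: field_simps)
  have "p * (1 - p) * D1 = - (real k * (1 - p) * b) + \<phi> * (s + z * (1 - 2 * p) / 2)"
    unfolding D1_def b_def[symmetric] z_def[symmetric] s_def[symmetric] \<phi>_def[symmetric] 
    using p p1 by (intro clear) auto
  also have "\<dots> = - (e * (real k / (real n * p)) + z * \<phi> / 2)"
  proof -
    have "e * (real k / (real n * p)) = s * s * b * (real k / (real n * p)) - \<phi> * (s * (real k / (real n * p)))"
      by (rule e_mult)
    also have "\<dots> = real k * (1 - p) * b - \<phi> * (s + z * (1 - p))"
      unfolding sk unfolding ss using n p p1 by simp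
    finally have ee: "e * (real k / (real n * p)) = real k * (1 - p) * b - \<phi> * (s + z * (1 - p))" .
    show ?thesis unfolding ee by (simp add: field_simps)
  qed
  also have "\<bar>\<dots>\<bar> \<le> \<bar>e\<bar> * (real k / (real n * p)) + \<bar>z * \<phi> / 2\<bar>"
    using np by (intro tri) simp
  also have "\<dots> \<le> 516 / 1000 * (1 / p) + 121 / 1000"
  proof (intro add_mono mult_mono zphi e)
    show "real k / (real n * p) \<le> 1 / p" using n p by (simp add: field_simps)
  qed (use np in auto)
  finally show "\<bar>p * (1 - p) * D1\<bar> \<le> 516 / 1000 / p + 121 / 1000" by simp
  have "p * (1 - p) * D2 = - (real (n - k) * p * b) + \<phi> * (s + z * (1 - 2 * p) / 2)"
    unfolding D2_def b_def[symmetric] z_def[symmetric] s_def[symmetric] \<phi>_def[symmetric] 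
    using p p1 by (intro clear) auto
  also have "\<dots> = - (e * (real (n - k) / (real n * (1 - p))) + - (z * \<phi> / 2))"
  proof -
    have "e * (real (n - k) / (real n * (1 - p))) 
        = s * s * b * (real (n - k) / (real n * (1 - p))) - \<phi> * (s * (real (n - k) / (real n * (1 - p))))"
      by (rule e_mult)
    also have "\<dots> = real (n - k) * p * b - \<phi> * (s - z * p)"
      unfolding sk' unfolding ss using n p p1 by simp
    finally have ee: "e * (real (n - k) / (real n * (1 - p))) = real (n - k) * p * b - \<phi> * (s - z * p)" .
    show ?thesis unfolding ee by (simp add: field_simps)
  qed
  also have "\<bar>\<dots>\<bar> \<le> \<bar>e\<bar> * (real (n - k) / (real n * (1 - p))) + \<bar>- (z * \<phi> / 2)\<bar>"
    using np by (intro tri) simp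
  also have "\<dots> \<le> 516 / 1000 * (1 / p) + 121 / 1000"
    unfolding abs_minus_cancel
  proof (intro add_mono mult_mono zphi e)
    have "real (n - k) / (real n * (1 - p)) \<le> real n / (real n * (1 - p))"
      using np by (intro divide_right_mono) auto
    also have "\<dots> = 1 / (1 - p)" using n by simp
    also have "\<dots> \<le> 1 / p" using p p1 by (intro divide_left_mono) auto
    finally show "real (n - k) / (real n * (1 - p)) \<le> 1 / p" .
  qed (use np in auto)
  finally show "\<bar>p * (1 - p) * D2\<bar> \<le> 516 / 1000 / p + 121 / 1000" by simp
qed

text \<open>
  The factor h = 1/((1 - 2u) sqrt u), where u = p (1 - p), is not monotone near p = 1/2, so
  the factors of L have to be taken together. For the part K with constant 0.271 the
  derivative of the product with h has, after removal of positive factors, the numerator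
  -((1 - 6u)^2 + 32 u^3). For the part A with constants 0.516 and 0.121 the decay of 1/p
  dominates the only dangerous case u > 1/6.
\<close>

lemma L_antimono:
  assumes a: "0 < a" "a \<le> b" "b \<le> 1 / 2"
  shows "L b \<le> L a"
proof -
  define h where "h p = 1 / ((1 - 2 * p * (1 - p)) * bin_sd 1 p)" for p
  define A where "A p = 516 / 1000 / p + 121 / 1000" for p :: real
  define K where "K p = (1 - 2 * p) * (1 + 2 * p * (1 - p)) / (1 - 2 * p * (1 - p))" for p :: real
  have L: "L p = h p * (A p + 271 / 1000 * K p)" for p
    by (simp add: L_def Let_def h_def A_def K_def sqrt_pq_eq)
  have "h b * (A b + 271 / 1000 * K b) \<le> h a * (A a + 271 / 1000 * K a)"
  proof (rule DERIV_nonpos_imp_nonincreasing[OF a(2)])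
    fix p assume "a \<le> p" "p \<le> b"
    then have p: "0 < p" "p < 1" "p \<le> 1 / 2" using a by linarith+
    note pq = pq_bounds[OF p(1,2)]
    define u where "u = p * (1 - p)"
    define w where "w = 1 - 2 * u"
    define s where "s = bin_sd 1 p"
    define \<delta> where "\<delta> = 1 - 2 * p"
    have u: "0 < u" "0 < w" "u \<le> 1 / 4" using pq by (auto simp: u_def w_def)
    have s: "0 < s" unfolding s_def using p by (intro bin_sd_pos) auto
    have \<delta>: "0 \<le> \<delta>" "\<delta> * \<delta> = 1 - 4 * u" using p by (auto simp: \<delta>_def u_def algebra_simps)
    have h: "h p = 1 / (w * s)" by (simp add: h_def w_def u_def s_def mult.assoc)
    have K: "K p = \<delta> * (1 + 2 * u) / w" by (simp add: K_def w_def u_def \<delta>_def mult.assoc)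
    have dw: "((\<lambda>p. 1 - 2 * p * (1 - p)) has_real_derivative - 2 * \<delta>) (at p)"
      by (auto intro!: derivative_eq_intros simp: \<delta>_def algebra_simps)
    have dh: "(h has_real_derivative - (h p * (\<delta> * (1 - 6 * u) / (2 * u * w)))) (at p)"
    proof -
      have "((\<lambda>p. (1 - 2 * p * (1 - p)) * bin_sd 1 p) has_real_derivative 
          - 2 * \<delta> * s + s * (\<delta> / 2) / u * w) (at p)"
        using DERIV_mult[OF dw DERIV_bin_sd[OF _ p(1,2), of 1]] by (simp add: s_def w_def u_def \<delta>_def mult.assoc)
      from DERIV_inverse'[OF this] have "(h has_real_derivative 
          - (inverse (w * s) * (- 2 * \<delta> * s + s * (\<delta> / 2) / u * w) * inverse (w * s))) (at p)"
        using u s by (simp add: h_def[abs_def] inverse_eq_divide s_def w_def u_def mult.assoc)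
      moreover have "inverse (w * s) * (- 2 * \<delta> * s + s * (\<delta> / 2) / u * w) * inverse (w * s)
        = h p * (\<delta> * (1 - 6 * u) / (2 * u * w))"
      proof -
        have "- 2 * \<delta> * s + s * (\<delta> / 2) / u * w = s * \<delta> * (w - 4 * u) / (2 * u)"
          using u by (simp add: field_simps)
        also have "w - 4 * u = 1 - 6 * u" by (simp add: w_def)
        finally show ?thesis using u s by (simp add: h divide_simps)
      qed
      ultimately show ?thesis by simp
    qed
    have dA: "(A has_real_derivative - (516 / 1000 / p\<^sup>2)) (at p)"
      unfolding A_def[abs_def] using p
      by (auto intro!: derivative_eq_intros simp: power2_eq_square)
    have dK: "(K has_real_derivative (2 - 16 * u + 8 * u\<^sup>2) / w\<^sup>2) (at p)"
    proof -
      have d1: "((\<lambda>p. (1 - 2 * p) * (1 + 2 * p * (1 - p))) has_real_derivative - 12 * u) (at p)"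
        by (auto intro!: derivative_eq_intros simp: u_def algebra_simps)
      have "(K has_real_derivative (- 12 * u * w - \<delta> * (1 + 2 * u) * (- 2 * \<delta>)) / (w * w)) (at p)"
        using DERIV_divide[OF d1 dw] u
        by (simp add: K_def[abs_def] w_def u_def \<delta>_def mult.assoc)
      moreover have "- 12 * u * w - \<delta> * (1 + 2 * u) * (- 2 * \<delta>) = 2 - 16 * u + 8 * u\<^sup>2"
      proof -
        have "- 12 * u * w - \<delta> * (1 + 2 * u) * (- 2 * \<delta>) = - 12 * u * w + 2 * (1 + 2 * u) * (\<delta> * \<delta>)"
          by simp
        also have "\<dots> = 2 - 16 * u + 8 * u\<^sup>2"
          unfolding \<delta> w_def by (simp add: power2_eq_square algebra_simps)
        finally show ?thesis .
      qed
      ultimately show ?thesis by (simp only: power2_eq_square[of w])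
    qed
    define g where "g = \<delta> * (1 - 6 * u) / (2 * u * w)"
    have deriv: "((\<lambda>p. h p * (A p + 271 / 1000 * K p)) has_real_derivative 
       - (h p * g) * (A p + 271 / 1000 * K p) 
        + (- (516 / 1000 / p\<^sup>2) + 271 / 1000 * ((2 - 16 * u + 8 * u\<^sup>2) / w\<^sup>2)) * h p) (at p)"
      unfolding g_def by (intro DERIV_mult DERIV_add DERIV_cmult dh dA dK)
    have partA: "- (516 / 1000 / p\<^sup>2) - g * A p \<le> 0"
    proof (cases "0 \<le> 1 - 6 * u")
      case True
      then have "0 \<le> g * A p" using \<delta> u p by (simp add: g_def A_def)
      moreover have "0 \<le> 516 / 1000 / p\<^sup>2" by simp
      ultimately show ?thesis by linarith
    next
      case False
      have "\<delta> * (6 * u - 1) * (516 / 1000 + 121 / 1000 * p) \<le> (1 - p) * (1 / 2) * (516 / 1000 * 2)"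
        using False u p \<delta> by (intro mult_mono) (auto simp: \<delta>_def)
      also have "\<dots> \<le> 2 * (1 - p) * w * (516 / 1000)"
      proof -
        have "(1 - p) * (1 / 2) \<le> (1 - p) * w" using u p by (intro mult_left_mono) (auto simp: w_def)
        then have "(1 - p) * (1 / 2) * (516 / 1000 * 2) \<le> (1 - p) * w * (516 / 1000 * 2)"
          by (rule mult_right_mono) simp
        then show ?thesis by (simp only: mult_ac)
      qed
      finally have le: "\<delta> * (6 * u - 1) * (516 / 1000 + 121 / 1000 * p) \<le> 2 * (1 - p) * w * (516 / 1000)" .
      have "- g * A p = \<delta> * (6 * u - 1) * (516 / 1000 + 121 / 1000 * p) / (2 * u * w * p)"
        using p u by (simp add: g_def A_def field_simps)
      also have "\<dots> \<le> 2 * (1 - p) * w * (516 / 1000) / (2 * u * w * p)"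
        using le u p by (intro divide_right_mono) auto
      also have "\<dots> = 516 / 1000 / p\<^sup>2"
      proof -
        have cancel: "2 * x * w * c / (2 * (p * x) * w * p) = c / p\<^sup>2" if "x \<noteq> 0" for x c
          using p u that by (simp add: power2_eq_square)
        show ?thesis unfolding u_def by (rule cancel) (use p in simp)
      qed
      finally show ?thesis by linarith
    qed
    have partK: "(2 - 16 * u + 8 * u\<^sup>2) / w\<^sup>2 - g * K p \<le> 0"
    proof -
      have gK: "g * K p = (\<delta> * \<delta>) * (1 - 6 * u) * (1 + 2 * u) / (2 * u * w\<^sup>2)"
        by (simp add: g_def K power2_eq_square mult_ac)
      have "(2 - 16 * u + 8 * u\<^sup>2) / w\<^sup>2 = (2 - 16 * u + 8 * u\<^sup>2) * (2 * u) / (2 * u * w\<^sup>2)"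
        using u by simp
      then have e: "(2 - 16 * u + 8 * u\<^sup>2) / w\<^sup>2 - g * K p
         = ((2 - 16 * u + 8 * u\<^sup>2) * (2 * u) - (\<delta> * \<delta>) * (1 - 6 * u) * (1 + 2 * u)) / (2 * u * w\<^sup>2)"
        unfolding gK by (simp only: diff_divide_distrib)
      have num: "(2 - 16 * u + 8 * u\<^sup>2) * (2 * u) - (\<delta> * \<delta>) * (1 - 6 * u) * (1 + 2 * u) 
          = - ((1 - 6 * u)\<^sup>2 + 32 * u ^ 3)"
        unfolding \<delta> by (simp add: power2_eq_square power3_eq_cube algebra_simps)
      have "0 \<le> (1 - 6 * u)\<^sup>2 + 32 * u ^ 3" using u by simp
      then have "- ((1 - 6 * u)\<^sup>2 + 32 * u ^ 3) \<le> 0" by linarith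
      then show ?thesis
        unfolding e num by (rule divide_nonpos_pos) (use u in simp)
    qed
    have "h p * ((- (516 / 1000 / p\<^sup>2) - g * A p) 
          + 271 / 1000 * ((2 - 16 * u + 8 * u\<^sup>2) / w\<^sup>2 - g * K p)) \<le> 0"
      using partA partK u s by (intro mult_nonneg_nonpos add_nonpos_nonpos) (auto simp: h)
    moreover have "- (h p * g) * (A p + 271 / 1000 * K p) 
        + (- (516 / 1000 / p\<^sup>2) + 271 / 1000 * ((2 - 16 * u + 8 * u\<^sup>2) / w\<^sup>2)) * h p
      = h p * ((- (516 / 1000 / p\<^sup>2) - g * A p) 
          + 271 / 1000 * ((2 - 16 * u + 8 * u\<^sup>2) / w\<^sup>2 - g * K p))"
    proof -
      have "- (x * g) * (y + c * z) + (- v + c * t) * x = x * ((- v - g * y) + c * (t - g * z))" for x y z c v t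
        by (simp add: algebra_simps)
      then show ?thesis .
    qed
    ultimately have "- (h p * g) * (A p + 271 / 1000 * K p) 
        + (- (516 / 1000 / p\<^sup>2) + 271 / 1000 * ((2 - 16 * u + 8 * u\<^sup>2) / w\<^sup>2)) * h p \<le> 0"
      by (simp only:)
    with deriv show "\<exists>D. ((\<lambda>p. h p * (A p + 271 / 1000 * K p)) has_real_derivative D) (at p) \<and> D \<le> 0"
      by blast
  qed
  then show ?thesis by (simp only: L)
qed

lemma rho_F_minus_G_lipschitz:
  assumes n: "0 < n" "k \<le> n" and a: "0 < a" and m: "m = k \<or> m = Suc k"
    and x: "x \<in> {a..1 / 2}" and y: "y \<in> {a..1 / 2}"
  defines "f \<equiv> \<lambda>p. 1 / rho p * ((\<Sum>j<m. Bernstein n j p) - Phi (bin_z n k p))"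
  shows "\<bar>f x - f y\<bar> \<le> L a * \<bar>x - y\<bar>"
proof -
  have "\<exists>D. (f has_real_derivative D) (at p) \<and> \<bar>D\<bar> \<le> L a" if p: "p \<in> {a..1 / 2}" for p
  proof -
    have p': "0 < p" "p < 1" "p \<le> 1 / 2" using p a by auto
    obtain D where "((\<lambda>p. (\<Sum>j<m. Bernstein n j p) - Phi (bin_z n k p)) has_real_derivative D) (at p)"
      "\<bar>p * (1 - p) * D\<bar> \<le> 516 / 1000 / p + 121 / 1000"
      using m deriv_F_minus_G_bounds[OF n p'(1,3)] by blast
    from abs_deriv_le_L[OF p' this(1) F_minus_Phi_bound[OF n p'(1,2) m] this(2)]
    obtain D' where "(f has_real_derivative D') (at p)" "\<bar>D'\<bar> \<le> L p"
      unfolding f_def by blast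
    moreover have "L p \<le> L a" using a p by (intro L_antimono) auto
    ultimately show ?thesis by (meson order_trans)
  qed
  then obtain D where D: "\<And>p. p \<in> {a..1 / 2} \<Longrightarrow> (f has_real_derivative D p) (at p) \<and> \<bar>D p\<bar> \<le> L a"
    by metis
  have "norm (f x - f y) \<le> L a * norm (x - y)"
    by (rule field_differentiable_bound[where S = "{a..1 / 2}" and f' = D])
       (use D x y in \<open>auto intro: has_field_derivative_at_within\<close>)
  then show ?thesis by simp
qed

section \<open>Comparison with the nearest node\<close>

lemma abs_max_diff_le:
  fixes a b c d :: real
  assumes "\<bar>a - c\<bar> \<le> e" "\<bar>b - d\<bar> \<le> e"
  shows "\<bar>max \<bar>a\<bar> \<bar>b\<bar> - max \<bar>c\<bar> \<bar>d\<bar>\<bar> \<le> e"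
  using assms by (auto simp: max_def abs_if split: if_splits)

lemma Delta_eq:
  assumes n: "0 < n" and p: "0 < p" "p < 1"
  shows "1 / rho p * Delta n (int k) p = 
    max \<bar>1 / rho p * ((\<Sum>j<k. Bernstein n j p) - Phi (bin_z n k p))\<bar>
        \<bar>1 / rho p * ((\<Sum>j<Suc k. Bernstein n j p) - Phi (bin_z n k p))\<bar>"
proof -
  have r: "0 \<le> 1 / rho p"
    unfolding inverse_rho_eq using pq_bounds[OF p] bin_sd_pos[of 1 p] p by (simp add: less_imp_le)
  have "G n p (real k) = Phi (bin_z n k p)"
    by (simp add: G_def bin_z_def bin_sd_def)
  moreover have "F n p (real k) = (\<Sum>j<k. Bernstein n j p)"
    "F n p (real (Suc k)) = (\<Sum>j<Suc k. Bernstein n j p)"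
    using n by (intro F_eq_sum_Bernstein p; simp)+
  ultimately have "Delta n (int k) p = max \<bar>(\<Sum>j<k. Bernstein n j p) - Phi (bin_z n k p)\<bar>
        \<bar>(\<Sum>j<Suc k. Bernstein n j p) - Phi (bin_z n k p)\<bar>"
    by (simp add: Delta_def add.commute)
  then show ?thesis
    by (simp only: abs_mult abs_of_nonneg[OF r] max_mult_distrib_left r if_True)
qed

text \<open>
  Rounding (p - a)/h to the nearest integer gives a node at distance at most h/2.
\<close>

lemma nearest_node_distance:
  assumes "h > 0" "a + real m * h = b" "a \<le> p" "p \<le> b"
    and nearest: "\<And>y. y \<in> grid_nodes a h m \<Longrightarrow> \<bar>p - p'\<bar> \<le> \<bar>p - y\<bar>"
  shows "\<bar>p - p'\<bar> \<le> h / 2"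
proof -
  define x where "x = (p - a) / h"
  have px: "p = a + x * h" using assms(1) by (simp add: x_def)
  have x: "0 \<le> x" "x \<le> real m"
    using assms by (auto simp: x_def field_simps)
  have "0 \<le> round x" "round x \<le> int m"
    using round_mono[OF x(1)] round_mono[OF x(2)] by simp_all
  then obtain j where j: "round x = int j" "j \<le> m"
    using zero_le_imp_eq_int by force
  have "\<bar>p - p'\<bar> \<le> \<bar>p - (a + real j * h)\<bar>"
    using j(2) by (intro nearest) (auto simp: grid_nodes_def)
  also have "p - (a + real j * h) = (x - real j) * h"
    by (simp add: px algebra_simps)
  also have "\<bar>\<dots>\<bar> = \<bar>x - real j\<bar> * h" using assms(1) by (simp add: abs_mult)
  also have "\<dots> \<le> 1 / 2 * h"
    using of_int_round_abs_le[of x] j(1) assms(1) by (intro mult_right_mono) (auto simp: abs_minus_commute)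
  finally show ?thesis by simp
qed

theorem theorem2:
  fixes pstar p p' h :: real and m n :: nat and k :: int
  assumes "0 < pstar" and "pstar < p" and "p \<le> 0.5"
    and "h > 0" and "pstar + real m * h = 0.5"
    and "p' \<in> grid_nodes pstar h m"
    and "\<And>y. y \<in> grid_nodes pstar h m \<Longrightarrow> \<bar>p - p'\<bar> \<le> \<bar>p - y\<bar>"
    and "n \<ge> 1" and "0 \<le> k" and "k \<le> int n"
  shows "\<bar>1 / rho p * Delta n k p - 1 / rho p' * Delta n k p'\<bar> \<le> h / 2 * L pstar"
proof -
  obtain i where k: "k = int i" "i \<le> n" using assms(9,10) zero_le_imp_eq_int by force
  have n: "0 < n" using assms(8) by simp
  obtain j where j: "p' = pstar + real j * h" "j \<le> m"
    using assms(6) by (auto simp: grid_nodes_def)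
  have "real j * h \<le> real m * h" "0 \<le> real j * h" using j(2) assms(4) by (auto intro: mult_right_mono)
  then have p': "p' \<in> {pstar..1 / 2}" using assms(5) j(1) by simp
  have p: "p \<in> {pstar..1 / 2}" using assms(2,3) by simp
  have dist: "\<bar>p - p'\<bar> \<le> h / 2"
    by (rule nearest_node_distance[OF assms(4,5) _ assms(3,7)]) (use assms(2) in simp)
  have "0 \<le> L pstar"
  proof -
    have "pstar < 1" "0 \<le> 1 - 2 * pstar" using assms(2,3) by auto
    then show ?thesis
      using pq_bounds[of pstar] assms(1) by (auto simp: L_def Let_def intro!: mult_nonneg_nonneg add_nonneg_nonneg)
  qed
  then have L: "L pstar * \<bar>p - p'\<bar> \<le> h / 2 * L pstar"
    using dist by (subst mult.commute) (rule mult_right_mono)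
  have eq: "1 / rho q * Delta n k q = 
    max \<bar>1 / rho q * ((\<Sum>j<i. Bernstein n j q) - Phi (bin_z n i q))\<bar>
        \<bar>1 / rho q * ((\<Sum>j<Suc i. Bernstein n j q) - Phi (bin_z n i q))\<bar>" if "q \<in> {pstar..1 / 2}" for q
    unfolding k(1) using that assms(1) n by (intro Delta_eq) auto
  show ?thesis
    unfolding eq[OF p] eq[OF p']
    by (intro abs_max_diff_le order_trans[OF rho_F_minus_G_lipschitz[OF n k(2) assms(1) _ p p'] L]) auto
qed

end
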